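(* For any two physical systems $A$ and $A'$, the set $\mathrm{CTO}(A\to A')$ is convex.
   Context: Every physical system $X$ is finite dimensional with a Hamiltonian $H^X$ (Hermitian, positive semidefinite); composite systems of non-interacting parts have Hamiltonian $H^{XY}=H^X\otimes I^Y+I^X\otimes H^Y$. For a fixed inverse temperature $\beta>0$, the Gibbs state of $X$ is $\gamma^X=e^{-\beta H^X}/\mathrm{Tr}[e^{-\beta H^X}]$. A thermal operation from $A$ to $A'$ is a quantum channel (CPTP map) obtainable by composing: (i) appending any system $C$ (of arbitrary finite dimension) prepared in its Gibbs state $\gamma^C$; (ii) applying a unitary on a composite system commuting with its total Hamiltonian; (iii) tracing out subsystems. $\mathrm{TO}(A\to A')$ denotes the set of thermal operations from $A$ to $A'$, and $\mathrm{CTO}(A\to A')$ (closed thermal operations) is its closure: the set of channels $\mathcal{E}:A\to A'$ such that $\mathcal{E}=\lim_{k\to\infty}\mathcal{E}_k$ for some sequence $\mathcal{E}_k\in\mathrm{TO}(A\to A')$. *)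

theory Defs
  imports "HOL-Analysis.Analysis" "Jordan_Normal_Form.Matrix"
begin

text \<open>A physical system is identified with its Hamiltonian: a square complex matrix
  (Hermitian, positive semidefinite); its dimension is the matrix dimension.\<close>

definition cadj :: "complex mat \<Rightarrow> complex mat" where
  "cadj M = mat (dim_col M) (dim_row M) (\<lambda>(i,j). cnj (M $$ (j,i)))"

definition is_hamiltonian :: "complex mat \<Rightarrow> bool" where
  "is_hamiltonian H \<longleftrightarrow> dim_row H = dim_col H \<and> 0 < dim_row H \<and> cadj H = H \<and>
     (\<forall>v :: nat \<Rightarrow> complex. 0 \<le> Re (\<Sum>i<dim_row H. \<Sum>j<dim_row H. cnj (v i) * H $$ (i,j) * v j))"

definition is_unitary :: "complex mat \<Rightarrow> bool" where
  "is_unitary U \<longleftrightarrow> dim_row U = dim_col U \<and> U * cadj U = 1\<^sub>m (dim_row U) \<and> cadj U * U = 1\<^sub>m (dim_row U)"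

definition kron :: "complex mat \<Rightarrow> complex mat \<Rightarrow> complex mat" where
  "kron A B = mat (dim_row A * dim_row B) (dim_col A * dim_col B)
     (\<lambda>(i,j). A $$ (i div dim_row B, j div dim_col B) * B $$ (i mod dim_row B, j mod dim_col B))"

text \<open>Hamiltonian of a composite of non-interacting parts: H^X \<otimes> I + I \<otimes> H^Y.\<close>
definition ham_comp :: "complex mat \<Rightarrow> complex mat \<Rightarrow> complex mat" where
  "ham_comp HX HY = kron HX (1\<^sub>m (dim_row HY)) + kron (1\<^sub>m (dim_row HX)) HY"

definition ptrace2 :: "nat \<Rightarrow> nat \<Rightarrow> complex mat \<Rightarrow> complex mat" where
  "ptrace2 m n M = mat m m (\<lambda>(i,j). \<Sum>k<n. M $$ (i*n+k, j*n+k))"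

definition ptrace1 :: "nat \<Rightarrow> nat \<Rightarrow> complex mat \<Rightarrow> complex mat" where
  "ptrace1 m n M = mat n n (\<lambda>(i,j). \<Sum>k<m. M $$ (k*n+i, k*n+j))"

definition swap_sys :: "nat \<Rightarrow> nat \<Rightarrow> complex mat \<Rightarrow> complex mat" where
  "swap_sys m n M = mat (n*m) (n*m)
     (\<lambda>(i,j). M $$ ((i mod m)*n + i div m, (j mod m)*n + j div m))"

definition mtrace :: "complex mat \<Rightarrow> complex" where
  "mtrace M = (\<Sum>i<dim_row M. M $$ (i,i))"

definition mexp :: "complex mat \<Rightarrow> complex mat" where
  "mexp M = mat (dim_row M) (dim_col M)
     (\<lambda>(i,j). \<Sum>k. (M ^\<^sub>m k) $$ (i,j) / of_nat (fact k))"

definition gibbs :: "real \<Rightarrow> complex mat \<Rightarrow> complex mat" where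
  "gibbs \<beta> H = (1 / mtrace (mexp (complex_of_real (- \<beta>) \<cdot>\<^sub>m H))) \<cdot>\<^sub>m mexp (complex_of_real (- \<beta>) \<cdot>\<^sub>m H)"

inductive elem_step :: "real \<Rightarrow> complex mat \<Rightarrow> complex mat \<Rightarrow> (complex mat \<Rightarrow> complex mat) \<Rightarrow> bool"
  for \<beta> :: real where
  append_right: "is_hamiltonian X \<Longrightarrow> is_hamiltonian C \<Longrightarrow>
     elem_step \<beta> X (ham_comp X C) (\<lambda>\<rho>. kron \<rho> (gibbs \<beta> C))"
| append_left: "is_hamiltonian X \<Longrightarrow> is_hamiltonian C \<Longrightarrow>
     elem_step \<beta> X (ham_comp C X) (\<lambda>\<rho>. kron (gibbs \<beta> C) \<rho>)"
| unitary: "is_hamiltonian X \<Longrightarrow> U \<in> carrier_mat (dim_row X) (dim_row X) \<Longrightarrow> is_unitary U \<Longrightarrow>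
     U * X = X * U \<Longrightarrow> elem_step \<beta> X X (\<lambda>\<rho>. U * \<rho> * cadj U)"
| trace_right: "is_hamiltonian X \<Longrightarrow> is_hamiltonian Y \<Longrightarrow>
     elem_step \<beta> (ham_comp X Y) X (ptrace2 (dim_row X) (dim_row Y))"
| trace_left: "is_hamiltonian X \<Longrightarrow> is_hamiltonian Y \<Longrightarrow>
     elem_step \<beta> (ham_comp X Y) Y (ptrace1 (dim_row X) (dim_row Y))"
| relabel: "is_hamiltonian X \<Longrightarrow> is_hamiltonian Y \<Longrightarrow>
     elem_step \<beta> (ham_comp X Y) (ham_comp Y X) (swap_sys (dim_row X) (dim_row Y))"

inductive thermal_op :: "real \<Rightarrow> complex mat \<Rightarrow> complex mat \<Rightarrow> (complex mat \<Rightarrow> complex mat) \<Rightarrow> bool"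
  for \<beta> :: real where
  refl: "is_hamiltonian X \<Longrightarrow> thermal_op \<beta> X X (\<lambda>\<rho>. \<rho>)"
| step: "thermal_op \<beta> X Y f \<Longrightarrow> elem_step \<beta> Y Z g \<Longrightarrow> thermal_op \<beta> X Z (g \<circ> f)"

definition mat_tendsto :: "(nat \<Rightarrow> complex mat) \<Rightarrow> complex mat \<Rightarrow> bool" where
  "mat_tendsto Xs L \<longleftrightarrow> (\<forall>k. Xs k \<in> carrier_mat (dim_row L) (dim_col L)) \<and>
     (\<forall>i<dim_row L. \<forall>j<dim_col L. (\<lambda>k. Xs k $$ (i,j)) \<longlonglongrightarrow> L $$ (i,j))"

text \<open>Closed thermal operations: (pointwise, equivalently norm) limits of thermal operations,
  as maps on operators of the input system.\<close>
definition CTO :: "real \<Rightarrow> complex mat \<Rightarrow> complex mat \<Rightarrow> (complex mat \<Rightarrow> complex mat) set" where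
  "CTO \<beta> A A' = {E. \<exists>Es :: nat \<Rightarrow> complex mat \<Rightarrow> complex mat.
      (\<forall>k. thermal_op \<beta> A A' (Es k)) \<and>
      (\<forall>\<rho> \<in> carrier_mat (dim_row A) (dim_row A). mat_tendsto (\<lambda>k. Es k \<rho>) (E \<rho>))}"

end

theory Submission
  imports Defs "Jordan_Normal_Form.Determinant"
begin

text \<open>Every thermal operation has a dilation: append a product of Gibbs states, apply a unitary that
  intertwines the Hamiltonian of \<open>X \<otimes> C\<close> with that of some \<open>L \<otimes> Y\<close>, discard \<open>L\<close>. Two such
  operations can be given the same ancilla, and by swapping the output into a fresh Gibbs copy of the
  output system and undoing the dilation, both become energy-conserving unitaries on one and the same
  system. A fully degenerate \<open>n\<close>-level system has the maximally mixed Gibbs state, and using it as a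
  control register realises every mixture with weights \<open>m/n\<close> and \<open>1 - m/n\<close> exactly. Approximating the weight
  by rationals along the sequences of thermal operations gives the mixture of the limits.\<close>

text \<open>The obstacle: conditional application needs a block-diagonal unitary that commutes with
  one total Hamiltonian, whereas the dilating unitaries of two operations lead to environments that
  depend on the operation. Padding makes the ancillas agree, but not the environments. Returning to
  the input factorisation removes the environment from the description: once the output is stored in
  the fresh copy, the inverse of the dilating unitary touches only what is about to be discarded, so
  it cannot change the result. The control register has zero Hamiltonian, so every operator on it
  conserves energy, and a weight is the share of the first \<open>m\<close> among \<open>n\<close>
  equally likely levels. Thermal operations themselves are thus already closed under rational
  mixtures; the closure supplies the remaining weights. All tensor bookkeeping uses equalities of
  matrices: \<open>kron\<close> is strictly associative and unital, so the only rearrangements of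
  factors are explicit swaps.\<close>

section \<open>Index arithmetic for product systems\<close>

lemma sum_prod_index:
  fixes f :: "nat \<Rightarrow> 'a::comm_monoid_add"
  shows "(\<Sum>i<m * n. f i) = (\<Sum>a<m. \<Sum>b<n. f (a * n + b))"
proof -
  have "(\<Sum>i<m * n. f i) = (\<Sum>a<m. sum f {a * n..<a * n + n})"
    by (rule sum.nat_group[symmetric])
  also have "\<dots> = (\<Sum>a<m. \<Sum>b<n. f (a * n + b))"
  proof (rule sum.cong[OF HOL.refl])
    fix a
    show "sum f {a * n..<a * n + n} = (\<Sum>b<n. f (a * n + b))"
      using sum.shift_bounds_nat_ivl[of f 0 "a * n" n]
      by (simp add: atLeast0LessThan add.commute)
  qed
  finally show ?thesis .
qed

lemma pair_index_less: "(a::nat) < m \<Longrightarrow> b < n \<Longrightarrow> a * n + b < m * n"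
proof -
  assume "a < m" "b < n"
  then have "a * n + b < Suc a * n" by simp
  also have "\<dots> \<le> m * n" using \<open>a < m\<close> by (intro mult_le_mono1) simp
  finally show ?thesis .
qed

lemma div_less_factor: "(i::nat) < m * n \<Longrightarrow> i div n < m"
  by (rule less_mult_imp_div_less)

lemma mod_less_factor: "(i::nat) < m * n \<Longrightarrow> i mod n < n"
  by (metis mod_less_divisor mult_0_right not_gr_zero not_less_zero)

section \<open>Adjoints and Kronecker products\<close>

lemma dim_cadj [simp]: "dim_row (cadj M) = dim_col M" "dim_col (cadj M) = dim_row M"
  by (simp_all add: cadj_def)

lemma cadj_carrier [simp]: "M \<in> carrier_mat m n \<Longrightarrow> cadj M \<in> carrier_mat n m"
  unfolding carrier_mat_def by simp

lemma cadj_index [simp]: "i < dim_col M \<Longrightarrow> j < dim_row M \<Longrightarrow> cadj M $$ (i,j) = cnj (M $$ (j,i))"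
  by (simp add: cadj_def)

lemma cadj_cadj [simp]: "cadj (cadj M) = M"
  by (intro eq_matI) auto

lemma cadj_one [simp]: "cadj (1\<^sub>m n) = 1\<^sub>m n"
  by (intro eq_matI) auto

lemma cadj_add: "M \<in> carrier_mat m n \<Longrightarrow> N \<in> carrier_mat m n \<Longrightarrow> cadj (M + N) = cadj M + cadj N"
  by (intro eq_matI) auto

lemma cadj_mult:
  assumes "M \<in> carrier_mat l m" "N \<in> carrier_mat m n"
  shows "cadj (M * N) = cadj N * cadj M"
  using assms by (intro eq_matI) (auto simp: scalar_prod_def mult.commute intro!: sum.cong)

lemma dim_kron [simp]: "dim_row (kron A B) = dim_row A * dim_row B" "dim_col (kron A B) = dim_col A * dim_col B"
  by (simp_all add: kron_def)

lemma kron_carrier [simp]: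
  "A \<in> carrier_mat m n \<Longrightarrow> B \<in> carrier_mat k l \<Longrightarrow> kron A B \<in> carrier_mat (m * k) (n * l)"
  unfolding carrier_mat_def by simp

lemma kron_index:
  "i < dim_row A * dim_row B \<Longrightarrow> j < dim_col A * dim_col B \<Longrightarrow>
   kron A B $$ (i,j) = A $$ (i div dim_row B, j div dim_col B) * B $$ (i mod dim_row B, j mod dim_col B)"
  by (simp add: kron_def)

lemma kron_pair_index:
  assumes "A \<in> carrier_mat m n" "B \<in> carrier_mat k l" "a < m" "b < k" "c < n" "d < l"
  shows "kron A B $$ (a * k + b, c * l + d) = A $$ (a,c) * B $$ (b,d)"
  using assms pair_index_less[of a m b k] pair_index_less[of c n d l]
  by (subst kron_index) auto

text \<open>Every row index below \<open>m * k\<close> has the form \<open>a * k + b\<close>.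
  Comparing entries at such composite indices keeps \<open>div\<close> and \<open>mod\<close> out of
  later proofs.\<close>

lemma eq_mat_pairI:
  assumes "A \<in> carrier_mat (m * k) (n * l)" "B \<in> carrier_mat (m * k) (n * l)"
    and "\<And>a b c d. a < m \<Longrightarrow> b < k \<Longrightarrow> c < n \<Longrightarrow> d < l \<Longrightarrow>
       A $$ (a * k + b, c * l + d) = B $$ (a * k + b, c * l + d)"
  shows "A = B"
proof (rule eq_matI)
  fix i j assume "i < dim_row B" "j < dim_col B"
  then have *: "i < m * k" "j < n * l" using assms by auto
  show "A $$ (i,j) = B $$ (i,j)"
    using assms(3)[of "i div k" "i mod k" "j div l" "j mod l"] *
    by (simp add: div_less_factor mod_less_factor)
qed (use assms in auto)

lemma mult_index:
  "A \<in> carrier_mat m n \<Longrightarrow> B \<in> carrier_mat n l \<Longrightarrow> i < m \<Longrightarrow> j < l \<Longrightarrow>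
    (A * B) $$ (i,j) = (\<Sum>k<n. A $$ (i,k) * B $$ (k,j))"
  by (auto simp: scalar_prod_def lessThan_atLeast0 intro!: sum.cong)

lemma kron_mult:
  assumes A: "A \<in> carrier_mat r m" and B: "B \<in> carrier_mat s n"
    and C: "C \<in> carrier_mat m u" and D: "D \<in> carrier_mat n v"
  shows "kron A B * kron C D = kron (A * C) (B * D)"
proof (rule eq_mat_pairI)
  show "kron A B * kron C D \<in> carrier_mat (r * s) (u * v)"
    by (rule mult_carrier_mat) (use assms in auto)
  have AC: "A * C \<in> carrier_mat r u" and BD: "B * D \<in> carrier_mat s v" using assms by auto
  then show "kron (A * C) (B * D) \<in> carrier_mat (r * s) (u * v)" by simp
  fix a b c d assume i: "a < r" "b < s" "c < u" "d < v"
  have "(kron A B * kron C D) $$ (a * s + b, c * v + d)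
     = (\<Sum>k<m * n. kron A B $$ (a * s + b, k) * kron C D $$ (k, c * v + d))"
    by (rule mult_index[of _ "r * s" _ _ "u * v"]) (use assms i in \<open>auto intro: pair_index_less\<close>)
  also have "\<dots> = (\<Sum>k<m. \<Sum>l<n. (A $$ (a,k) * C $$ (k,c)) * (B $$ (b,l) * D $$ (l,d)))"
    unfolding sum_prod_index
    by (intro sum.cong HOL.refl) (simp add: kron_pair_index[OF A B] kron_pair_index[OF C D] i)
  also have "\<dots> = (A * C) $$ (a,c) * (B * D) $$ (b,d)"
    by (simp only: mult_index[OF A C i(1,3)] mult_index[OF B D i(2,4)] sum_product)
  finally show "(kron A B * kron C D) $$ (a * s + b, c * v + d) = kron (A * C) (B * D) $$ (a * s + b, c * v + d)"
    by (simp add: kron_pair_index[OF AC BD] i)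
qed

text \<open>Packing a triple of indices into one number gives the same number for both bracketings.
  \<open>ham_comp_assoc\<close> and the composition of dilations inherit this strict
  equality.\<close>

lemma kron_assoc: "kron (kron A B) C = kron A (kron B C)"
proof (rule eq_matI)
  fix i j assume "i < dim_row (kron A (kron B C))" "j < dim_col (kron A (kron B C))"
  then have i: "i < dim_row A * (dim_row B * dim_row C)" and j: "j < dim_col A * (dim_col B * dim_col C)"
    by auto
  have i': "i < (dim_row A * dim_row B) * dim_row C" "j < (dim_col A * dim_col B) * dim_col C"
    using i j by (auto simp: mult.assoc)
  have [simp]: "i mod (dim_row B * dim_row C) < dim_row B * dim_row C" "j mod (dim_col B * dim_col C) < dim_col B * dim_col C"
    using mod_less_factor[OF i] mod_less_factor[OF j] by auto
  \<comment> \<open>The three digits of a composite index agree whether it is split first at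
    \<open>b * c\<close> or first at \<open>c\<close>. The bound on \<open>k\<close> forces
    \<open>c > 0\<close>, which the cancelling division by \<open>c\<close> relies on.\<close>
  have e: "k mod (b * c) div c = k div c mod b" "k mod (b * c) mod c = k mod c" 
    "k div (b * c) = k div c div b" if "k < a * (b * c)" for a b c k :: nat
  proof -
    have "c > 0" using that by (cases c) auto
    have "k mod (b * c) = c * (k div c mod b) + k mod c"
      using mod_mult2_eq[of k c b] by (simp add: mult.commute)
    then show "k mod (b * c) div c = k div c mod b" using \<open>c > 0\<close> by simp
    show "k mod (b * c) mod c = k mod c" by (simp add: mod_mod_cancel)
    show "k div (b * c) = k div c div b" using div_mult2_eq[of k c b] by (simp only: mult.commute)
  qed
  show "kron (kron A B) C $$ (i,j) = kron A (kron B C) $$ (i,j)"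
    using i j i' div_less_factor[OF i'(1)] div_less_factor[OF i'(2)]
    by (simp add: kron_index e[OF i] e[OF j])
qed (auto simp: mult.assoc)

lemma kron_add_left:
  "A \<in> carrier_mat m n \<Longrightarrow> A' \<in> carrier_mat m n \<Longrightarrow> kron (A + A') B = kron A B + kron A' B"
  by (intro eq_matI) (auto simp: kron_index div_less_factor algebra_simps)

lemma kron_add_right:
  "B \<in> carrier_mat m n \<Longrightarrow> B' \<in> carrier_mat m n \<Longrightarrow> kron A (B + B') = kron A B + kron A B'"
  by (intro eq_matI) (auto simp: kron_index mod_less_factor algebra_simps)

lemma kron_zero_left: "kron (0\<^sub>m m n) B = 0\<^sub>m (m * dim_row B) (n * dim_col B)"
  by (intro eq_matI) (auto simp: kron_index div_less_factor)

lemma kron_zero_right: "kron A (0\<^sub>m m n) = 0\<^sub>m (dim_row A * m) (dim_col A * n)"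
  by (intro eq_matI) (auto simp: kron_index mod_less_factor)

lemma kron_smult_left: "kron (a \<cdot>\<^sub>m A) B = a \<cdot>\<^sub>m kron A B"
  by (intro eq_matI) (auto simp: kron_index div_less_factor)

lemma kron_one [simp]: "kron (1\<^sub>m m) (1\<^sub>m n) = 1\<^sub>m (m * n)"
proof (rule eq_mat_pairI)
  fix a b c d assume "a < m" "b < n" "c < m" "d < n"
  moreover from this have "a * n + b = c * n + d \<longleftrightarrow> a = c \<and> b = d"
    by (metis div_mult_self3 div_less add_0_right mod_less mod_mult_self3 gr_implies_not0)
  ultimately show "kron (1\<^sub>m m) (1\<^sub>m n) $$ (a * n + b, c * n + d) = 1\<^sub>m (m * n) $$ (a * n + b, c * n + d)"
    by (auto simp: kron_pair_index[of _ m m _ n n] pair_index_less)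
qed auto

lemma kron_one_one_left [simp]: "kron (1\<^sub>m (Suc 0)) A = A"
  by (intro eq_matI) (auto simp: kron_index)

lemma kron_one_one_right [simp]: "kron A (1\<^sub>m (Suc 0)) = A"
  by (intro eq_matI) (auto simp: kron_index)

lemma cadj_kron: "cadj (kron A B) = kron (cadj A) (cadj B)"
  by (intro eq_matI) (auto simp: kron_index div_less_factor mod_less_factor)

section \<open>Partial traces and swaps\<close>

lemma ptrace1_carrier [simp]: "ptrace1 m n M \<in> carrier_mat n n"
  by (simp add: ptrace1_def)

lemma dim_ptrace1 [simp]: "dim_row (ptrace1 m n M) = n" "dim_col (ptrace1 m n M) = n"
  by (simp_all add: ptrace1_def)

lemma ptrace1_index [simp]:
  "i < n \<Longrightarrow> j < n \<Longrightarrow> ptrace1 m n M $$ (i,j) = (\<Sum>k<m. M $$ (k * n + i, k * n + j))"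
  by (simp add: ptrace1_def)

lemma ptrace1_add:
  assumes "M \<in> carrier_mat (m * n) (m * n)" "N \<in> carrier_mat (m * n) (m * n)"
  shows "ptrace1 m n (M + N) = ptrace1 m n M + ptrace1 m n N"
  using assms by (intro eq_matI) (auto simp: pair_index_less sum.distrib intro!: sum.cong)

lemma ptrace1_smult:
  assumes "M \<in> carrier_mat (m * n) (m * n)"
  shows "ptrace1 m n (a \<cdot>\<^sub>m M) = a \<cdot>\<^sub>m ptrace1 m n M"
  using assms by (intro eq_matI) (auto simp: pair_index_less sum_distrib_left intro!: sum.cong)

lemma ptrace1_one [simp]: "M \<in> carrier_mat n n \<Longrightarrow> ptrace1 (Suc 0) n M = M"
  by (intro eq_matI) auto

lemma ptrace1_kron:
  assumes "A \<in> carrier_mat m m" "B \<in> carrier_mat n n"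
  shows "ptrace1 m n (kron A B) = mtrace A \<cdot>\<^sub>m B"
  using assms by (intro eq_matI) (auto simp: kron_pair_index[OF assms] mtrace_def sum_distrib_right)

text \<open>Regrouping \<open>h * (m * z) + (k * z + i)\<close> as
  \<open>(h * m + k) * z + i\<close> merges two successive discards into one.\<close>

lemma ptrace1_ptrace1:
  "ptrace1 m z (ptrace1 l (m * z) M) = ptrace1 (l * m) z M"
proof (rule eq_matI)
  fix i j assume "i < dim_row (ptrace1 (l * m) z M)" "j < dim_col (ptrace1 (l * m) z M)"
  then have ij: "i < z" "j < z" by auto
  have "ptrace1 m z (ptrace1 l (m * z) M) $$ (i,j)
     = (\<Sum>k<m. \<Sum>h<l. M $$ (h * (m * z) + (k * z + i), h * (m * z) + (k * z + j)))"
    using ij by (simp add: pair_index_less)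
  also have "\<dots> = (\<Sum>h<l. \<Sum>k<m. M $$ ((h * m + k) * z + i, (h * m + k) * z + j))"
    by (subst sum.swap) (simp add: algebra_simps)
  also have "\<dots> = ptrace1 (l * m) z M $$ (i,j)"
    using ij by (simp add: sum_prod_index)
  finally show "ptrace1 m z (ptrace1 l (m * z) M) $$ (i,j) = ptrace1 (l * m) z M $$ (i,j)" .
qed auto

text \<open>Discarding on the left and appending on the right act on opposite ends of the tensor
  product, hence commute. This postpones discards when dilations are composed.\<close>

lemma kron_ptrace1:
  assumes M: "M \<in> carrier_mat (l * y) (l * y)" and T: "T \<in> carrier_mat d d"
  shows "kron (ptrace1 l y M) T = ptrace1 l (y * d) (kron M T)"
proof (rule eq_mat_pairI)
  show "kron (ptrace1 l y M) T \<in> carrier_mat (y * d) (y * d)" using T by simp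
  fix a b e f assume i: "a < y" "b < d" "e < y" "f < d"
  have "ptrace1 l (y * d) (kron M T) $$ (a * d + b, e * d + f)
     = (\<Sum>k<l. kron M T $$ ((k * y + a) * d + b, (k * y + e) * d + f))"
    using i by (simp add: pair_index_less) (simp add: algebra_simps)
  also have "\<dots> = (\<Sum>k<l. M $$ (k * y + a, k * y + e) * T $$ (b,f))"
    by (intro sum.cong HOL.refl) (simp add: kron_pair_index[OF M T] pair_index_less i)
  finally show "kron (ptrace1 l y M) T $$ (a * d + b, e * d + f) = ptrace1 l (y * d) (kron M T) $$ (a * d + b, e * d + f)"
    using i by (simp add: kron_pair_index[OF ptrace1_carrier T] sum_distrib_right)
qed simp

text \<open>The identity on the discarded factor collapses the sum over its index, so
  \<open>W\<close> comes out of the trace.\<close>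

lemma ptrace1_mult_left:
  assumes W: "W \<in> carrier_mat n n" and M: "M \<in> carrier_mat (l * n) (l * n)"
  shows "ptrace1 l n (kron (1\<^sub>m l) W * M) = W * ptrace1 l n M"
proof (rule eq_matI)
  fix i j assume "i < dim_row (W * ptrace1 l n M)" "j < dim_col (W * ptrace1 l n M)"
  then have ij: "i < n" "j < n" using W by auto
  have "(kron (1\<^sub>m l) W * M) $$ (k * n + i, k * n + j) = (\<Sum>h<n. W $$ (i,h) * M $$ (k * n + h, k * n + j))"
    if "k < l" for k
  proof -
    have "(kron (1\<^sub>m l) W * M) $$ (k * n + i, k * n + j)
       = (\<Sum>a<l. \<Sum>h<n. (if k = a then 1 else 0) * W $$ (i,h) * M $$ (a * n + h, k * n + j))"
      by (subst mult_index[of _ "l * n" "l * n" _ "l * n"])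
        (use W M ij that in \<open>auto simp: sum_prod_index pair_index_less kron_pair_index[OF one_carrier_mat W] intro!: sum.cong\<close>)
    also have "\<dots> = (\<Sum>a<l. if k = a then (\<Sum>h<n. W $$ (i,h) * M $$ (a * n + h, k * n + j)) else 0)"
      by (intro sum.cong HOL.refl) auto
    finally show ?thesis using that by simp
  qed
  then have "ptrace1 l n (kron (1\<^sub>m l) W * M) $$ (i,j) = (\<Sum>k<l. \<Sum>h<n. W $$ (i,h) * M $$ (k * n + h, k * n + j))"
    using ij by simp
  also have "\<dots> = (W * ptrace1 l n M) $$ (i,j)"
    by (subst sum.swap) (simp add: mult_index[OF W ptrace1_carrier ij] sum_distrib_left ij)
  finally show "ptrace1 l n (kron (1\<^sub>m l) W * M) $$ (i,j) = (W * ptrace1 l n M) $$ (i,j)" .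
qed (use W in auto)

lemma cadj_ptrace1:
  assumes "M \<in> carrier_mat (l * n) (l * n)"
  shows "cadj (ptrace1 l n M) = ptrace1 l n (cadj M)"
  using assms by (intro eq_matI) (auto simp: pair_index_less intro!: sum.cong)

text \<open>Adjoints reverse products and commute with the partial trace, which reduces this to
  multiplication from the left.\<close>

lemma ptrace1_mult_right:
  assumes W: "W \<in> carrier_mat n n" and M: "M \<in> carrier_mat (l * n) (l * n)"
  shows "ptrace1 l n (M * kron (1\<^sub>m l) W) = ptrace1 l n M * W"
proof -
  have K: "kron (1\<^sub>m l) W \<in> carrier_mat (l * n) (l * n)" using W by simp
  have "cadj (ptrace1 l n (M * kron (1\<^sub>m l) W)) = ptrace1 l n (kron (1\<^sub>m l) (cadj W) * cadj M)"
    by (subst cadj_ptrace1) (use K M in \<open>auto simp: cadj_mult[OF M K] cadj_kron\<close>)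
  also have "\<dots> = cadj W * cadj (ptrace1 l n M)"
    by (subst ptrace1_mult_left) (use W M in \<open>auto simp: cadj_ptrace1[OF M]\<close>)
  also have "\<dots> = cadj (ptrace1 l n M * W)" by (rule cadj_mult[OF ptrace1_carrier W, symmetric])
  finally show ?thesis by (metis cadj_cadj)
qed

text \<open>Cyclicity of the trace in the discarded factor alone: the two summation indices of that
  factor are exchanged, while the index of the other factor passes through because \<open>V\<close>
  is padded with the identity there.\<close>

lemma ptrace1_kron_cyclic:
  assumes V: "V \<in> carrier_mat m m" and M: "M \<in> carrier_mat (m * n) (m * n)"
  shows "ptrace1 m n (kron V (1\<^sub>m n) * M) = ptrace1 m n (M * kron V (1\<^sub>m n))"
proof (rule eq_matI)
  fix i j assume "i < dim_row (ptrace1 m n (M * kron V (1\<^sub>m n)))" "j < dim_col (ptrace1 m n (M * kron V (1\<^sub>m n)))"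
  then have ij: "i < n" "j < n" by auto
  have l: "(kron V (1\<^sub>m n) * M) $$ (k * n + i, k * n + j) = (\<Sum>a<m. V $$ (k,a) * M $$ (a * n + i, k * n + j))"
    if "k < m" for k
  proof -
    have "(kron V (1\<^sub>m n) * M) $$ (k * n + i, k * n + j)
       = (\<Sum>a<m. \<Sum>h<n. V $$ (k,a) * (if i = h then 1 else 0) * M $$ (a * n + h, k * n + j))"
      by (subst mult_index[of _ "m * n" "m * n" _ "m * n"])
        (use V M ij that in \<open>auto simp: sum_prod_index pair_index_less kron_pair_index[OF V one_carrier_mat] intro!: sum.cong\<close>)
    also have "\<dots> = (\<Sum>a<m. \<Sum>h<n. if i = h then V $$ (k,a) * M $$ (a * n + h, k * n + j) else 0)"
      by (intro sum.cong HOL.refl) auto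
    finally show ?thesis using ij by simp
  qed
  have r: "(M * kron V (1\<^sub>m n)) $$ (k * n + i, k * n + j) = (\<Sum>a<m. V $$ (a,k) * M $$ (k * n + i, a * n + j))"
    if "k < m" for k
  proof -
    have "(M * kron V (1\<^sub>m n)) $$ (k * n + i, k * n + j)
       = (\<Sum>a<m. \<Sum>h<n. M $$ (k * n + i, a * n + h) * (V $$ (a,k) * (if h = j then 1 else 0)))"
      by (subst mult_index[of _ "m * n" "m * n" _ "m * n"])
        (use V M ij that in \<open>auto simp: sum_prod_index pair_index_less kron_pair_index[OF V one_carrier_mat] intro!: sum.cong\<close>)
    also have "\<dots> = (\<Sum>a<m. \<Sum>h<n. if h = j then V $$ (a,k) * M $$ (k * n + i, a * n + h) else 0)"
      by (intro sum.cong HOL.refl) auto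
    finally show ?thesis using ij by simp
  qed
  have "ptrace1 m n (kron V (1\<^sub>m n) * M) $$ (i,j) = (\<Sum>k<m. \<Sum>a<m. V $$ (k,a) * M $$ (a * n + i, k * n + j))"
    using ij by (simp add: l)
  also have "\<dots> = (\<Sum>k<m. \<Sum>a<m. V $$ (a,k) * M $$ (k * n + i, a * n + j))" by (rule sum.swap)
  also have "\<dots> = ptrace1 m n (M * kron V (1\<^sub>m n)) $$ (i,j)" using ij by (simp add: r)
  finally show "ptrace1 m n (kron V (1\<^sub>m n) * M) $$ (i,j) = ptrace1 m n (M * kron V (1\<^sub>m n)) $$ (i,j)" .
qed auto

section \<open>The swap of two tensor factors\<close>

text \<open>The permutation matrix behind \<open>swap_sys\<close>: row \<open>b * m + a\<close> has
  its 1 in column \<open>a * n + b\<close>. In this form the relabelling can enter a dilation as a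
  unitary.\<close>

definition swap_mat :: "nat \<Rightarrow> nat \<Rightarrow> complex mat" where
  "swap_mat m n = mat (n * m) (n * m) (\<lambda>(i,j). if j = (i mod m) * n + i div m then 1 else 0)"

lemma swap_mat_carrier [simp]: "swap_mat m n \<in> carrier_mat (n * m) (n * m)"
  by (simp add: swap_mat_def)

lemma dim_swap_mat [simp]: "dim_row (swap_mat m n) = n * m" "dim_col (swap_mat m n) = n * m"
  by (simp_all only: swap_mat_def dim_row_mat dim_col_mat)

lemma swap_sys_carrier [simp]: "swap_sys m n M \<in> carrier_mat (n * m) (n * m)"
  by (simp only: swap_sys_def mat_carrier)

lemma dim_swap_sys [simp]: "dim_row (swap_sys m n M) = n * m" "dim_col (swap_sys m n M) = n * m"
  by (simp_all only: swap_sys_def dim_row_mat dim_col_mat)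

lemma swap_index_less: "(i::nat) < n * m \<Longrightarrow> (i mod m) * n + i div m < n * m"
  using pair_index_less[of "i mod m" m "i div m" n] mod_less_factor[of i n m] div_less_factor[of i n m]
  by (simp only: mult.commute[of m n])

lemma swap_mat_conj:
  assumes M: "M \<in> carrier_mat (n * m) (n * m)"
  shows "swap_mat m n * M * cadj (swap_mat m n) = swap_sys m n M"
proof (rule eq_matI)
  let ?S = "swap_mat m n" and ?p = "\<lambda>i. (i mod m) * n + i div m"
  have SM: "?S * M \<in> carrier_mat (n * m) (n * m)"
    by (rule mult_carrier_mat[OF swap_mat_carrier M])
  have S: "?S $$ (i,k) = (if k = ?p i then 1 else 0)" if "i < n * m" "k < n * m" for i k
    using that by (simp add: swap_mat_def)
  have cS: "cadj ?S $$ (k,i) = (if k = ?p i then 1 else 0)" if "i < n * m" "k < n * m" for i k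
    using that S[OF that] by (simp add: cadj_index carrier_matD[OF swap_mat_carrier])
  have 1: "(?S * M) $$ (i,j) = M $$ (?p i, j)" if "i < n * m" "j < n * m" for i j
  proof -
    have "(?S * M) $$ (i,j) = (\<Sum>k<n * m. ?S $$ (i,k) * M $$ (k,j))"
      by (rule mult_index[OF swap_mat_carrier M that])
    also have "\<dots> = (\<Sum>k<n * m. if k = ?p i then M $$ (k,j) else 0)"
      by (intro sum.cong HOL.refl) (simp add: S that)
    also have "\<dots> = M $$ (?p i, j)"
      by (subst sum.delta) (use swap_index_less[OF that(1)] in auto)
    finally show ?thesis .
  qed
  fix i j assume "i < dim_row (swap_sys m n M)" "j < dim_col (swap_sys m n M)"
  then have ij: "i < n * m" "j < n * m" by auto
  have "(?S * M * cadj ?S) $$ (i,j) = (\<Sum>k<n * m. (?S * M) $$ (i,k) * cadj ?S $$ (k,j))"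
    by (rule mult_index[OF SM cadj_carrier[OF swap_mat_carrier] ij])
  also have "\<dots> = (\<Sum>k<n * m. if k = ?p j then M $$ (?p i, k) else 0)"
    by (intro sum.cong HOL.refl) (simp add: 1 cS ij del: cadj_index)
  also have "\<dots> = M $$ (?p i, ?p j)"
    by (subst sum.delta) (use swap_index_less[OF ij(2)] in auto)
  finally have "(?S * M * cadj ?S) $$ (i,j) = M $$ (?p i, ?p j)" .
  then show "(?S * M * cadj ?S) $$ (i,j) = swap_sys m n M $$ (i,j)"
    using ij by (simp only: swap_sys_def index_mat prod.case)
qed (simp_all only: index_mult_mat dim_cadj dim_swap_mat dim_swap_sys)

lemma swap_sys_kron:
  assumes A: "A \<in> carrier_mat m m" and B: "B \<in> carrier_mat n n"
  shows "swap_sys m n (kron A B) = kron B A"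
proof (rule eq_mat_pairI)
  show "swap_sys m n (kron A B) \<in> carrier_mat (n * m) (n * m)" by simp
  fix a b c d assume "a < n" "b < m" "c < n" "d < m"
  then show "swap_sys m n (kron A B) $$ (a * m + b, c * m + d) = kron B A $$ (a * m + b, c * m + d)"
    by (simp add: swap_sys_def pair_index_less kron_pair_index[OF A B] kron_pair_index[OF B A])
qed (use assms in auto)

lemma swap_sys_add:
  assumes "M \<in> carrier_mat (m * n) (m * n)" "N \<in> carrier_mat (m * n) (m * n)"
  shows "swap_sys m n (M + N) = swap_sys m n M + swap_sys m n N"
  using assms by (intro eq_matI) (auto simp: swap_sys_def swap_index_less mult.commute[of m n])

text \<open>Reduces discards on the right to discards on the left, so that the calculus of
  \<open>ptrace1\<close> covers both.\<close>

lemma ptrace2_swap_sys: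
  "ptrace2 m n M = ptrace1 n m (swap_sys m n M)"
  by (intro eq_matI) (auto simp: ptrace2_def swap_sys_def pair_index_less intro!: sum.cong)

section \<open>Hamiltonians\<close>

lemma dim_ham_comp [simp]:
  "dim_row (ham_comp X Y) = dim_row X * dim_row Y" "dim_col (ham_comp X Y) = dim_row X * dim_col Y"
  by (simp_all add: ham_comp_def)

lemma ham_comp_carrier [simp]:
  "X \<in> carrier_mat m m \<Longrightarrow> Y \<in> carrier_mat n n \<Longrightarrow> ham_comp X Y \<in> carrier_mat (m * n) (m * n)"
  unfolding carrier_mat_def by simp

lemma is_hamiltonian_carrier: "is_hamiltonian X \<Longrightarrow> X \<in> carrier_mat (dim_row X) (dim_row X)"
  unfolding is_hamiltonian_def carrier_mat_def by simp

lemma ham_comp_pair_index: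
  assumes X: "X \<in> carrier_mat m m" and Y: "Y \<in> carrier_mat n n"
    and i: "a < m" "b < n" "c < m" "d < n"
  shows "ham_comp X Y $$ (a * n + b, c * n + d)
     = X $$ (a,c) * (if b = d then 1 else 0) + (if a = c then 1 else 0) * Y $$ (b,d)"
  using X Y i
  by (simp add: ham_comp_def pair_index_less kron_pair_index[OF X one_carrier_mat]
      kron_pair_index[OF one_carrier_mat Y])

lemma ham_comp_assoc:
  assumes X: "X \<in> carrier_mat x x" and Y: "Y \<in> carrier_mat y y" and Z: "Z \<in> carrier_mat z z"
  shows "ham_comp (ham_comp X Y) Z = ham_comp X (ham_comp Y Z)"
proof -
  have d: "dim_row X = x" "dim_row Y = y" "dim_row Z = z" using assms by auto
  have "ham_comp (ham_comp X Y) Z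
      = kron X (1\<^sub>m (y * z)) + kron (kron (1\<^sub>m x) Y) (1\<^sub>m z) + kron (1\<^sub>m (x * y)) Z"
    unfolding ham_comp_def d
    by (subst kron_add_left[of _ "x * y" "x * y"]) (use assms in \<open>auto simp: kron_assoc\<close>)
  also have "\<dots> = kron X (1\<^sub>m (y * z)) + (kron (1\<^sub>m x) (kron Y (1\<^sub>m z)) + kron (1\<^sub>m x) (kron (1\<^sub>m y) Z))"
    by (subst assoc_add_mat[of _ "x * (y * z)" "x * (y * z)"])
      (use assms in \<open>auto simp: kron_assoc[symmetric] mult.assoc[symmetric]\<close>)
  also have "kron (1\<^sub>m x) (kron Y (1\<^sub>m z)) + kron (1\<^sub>m x) (kron (1\<^sub>m y) Z)
      = kron (1\<^sub>m x) (kron Y (1\<^sub>m z) + kron (1\<^sub>m y) Z)"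
    by (rule kron_add_right[of _ "y * z" "y * z", symmetric]) (use assms in auto)
  finally show ?thesis unfolding ham_comp_def d by (simp add: d)
qed

lemma ham_comp_trivial [simp]:
  assumes "X \<in> carrier_mat n n"
  shows "ham_comp X (0\<^sub>m (Suc 0) (Suc 0)) = X" "ham_comp (0\<^sub>m (Suc 0) (Suc 0)) X = X"
  using assms by (simp_all add: ham_comp_def kron_zero_left kron_zero_right)

lemma is_hamiltonian_zero: "0 < n \<Longrightarrow> is_hamiltonian (0\<^sub>m n n)"
proof -
  have "cadj (0\<^sub>m n n) = 0\<^sub>m n n" by (intro eq_matI) auto
  then show "0 < n \<Longrightarrow> is_hamiltonian (0\<^sub>m n n)" by (simp add: is_hamiltonian_def)
qed

text \<open>For positivity, the quadratic form at \<open>v\<close> splits: the term with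
  \<open>X\<close> is a sum over \<open>b\<close> of the form of \<open>X\<close> at the slice
  \<open>v (_ * n + b)\<close>, and the term with \<open>Y\<close> is a sum over \<open>a\<close> of
  the form of \<open>Y\<close> at the complementary slice. Each summand is nonnegative.\<close>

lemma is_hamiltonian_ham_comp:
  assumes hX: "is_hamiltonian X" and hY: "is_hamiltonian Y"
  shows "is_hamiltonian (ham_comp X Y)"
proof -
  define m n where "m = dim_row X" and "n = dim_row Y"
  have X: "X \<in> carrier_mat m m" and Y: "Y \<in> carrier_mat n n"
    using is_hamiltonian_carrier hX hY by (auto simp: m_def n_def)
  have [simp]: "dim_row X = m" "dim_row Y = n" by (simp_all add: m_def n_def)
  have psdX: "0 \<le> Re (\<Sum>i<m. \<Sum>j<m. cnj (v i) * X $$ (i,j) * v j)" for v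
    using hX unfolding is_hamiltonian_def m_def by blast
  have psdY: "0 \<le> Re (\<Sum>i<n. \<Sum>j<n. cnj (v i) * Y $$ (i,j) * v j)" for v
    using hY unfolding is_hamiltonian_def n_def by blast
  have "cadj (ham_comp X Y) = ham_comp X Y"
    unfolding ham_comp_def
    by (subst cadj_add[of _ "m * n" "m * n"])
      (use X Y hX hY in \<open>auto simp: cadj_kron is_hamiltonian_def\<close>)
  moreover have "0 \<le> Re (\<Sum>i<m * n. \<Sum>j<m * n. cnj (v i) * ham_comp X Y $$ (i,j) * v j)" for v
  proof -
    let ?v = "\<lambda>a b. v (a * n + b)"
    have "(\<Sum>i<m * n. \<Sum>j<m * n. cnj (v i) * ham_comp X Y $$ (i,j) * v j)
      = (\<Sum>a<m. \<Sum>b<n. \<Sum>c<m. \<Sum>d<n. cnj (?v a b) *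
          (X $$ (a,c) * (if b = d then 1 else 0) + (if a = c then 1 else 0) * Y $$ (b,d)) * ?v c d)"
      unfolding sum_prod_index by (intro sum.cong HOL.refl) (simp add: ham_comp_pair_index[OF X Y])
    also have "\<dots> = (\<Sum>a<m. \<Sum>b<n. \<Sum>c<m. \<Sum>d<n. (if b = d then cnj (?v a b) * X $$ (a,c) * ?v c d else 0))
       + (\<Sum>a<m. \<Sum>b<n. \<Sum>c<m. \<Sum>d<n. (if a = c then cnj (?v a b) * Y $$ (b,d) * ?v c d else 0))"
      unfolding sum.distrib[symmetric] by (intro sum.cong HOL.refl) (auto simp: algebra_simps)
    also have "(\<Sum>a<m. \<Sum>b<n. \<Sum>c<m. \<Sum>d<n. (if b = d then cnj (?v a b) * X $$ (a,c) * ?v c d else 0))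
       = (\<Sum>b<n. \<Sum>a<m. \<Sum>c<m. cnj (?v a b) * X $$ (a,c) * ?v c b)"
      by (subst sum.swap) simp
    also have "(\<Sum>a<m. \<Sum>b<n. \<Sum>c<m. \<Sum>d<n. (if a = c then cnj (?v a b) * Y $$ (b,d) * ?v c d else 0))
       = (\<Sum>a<m. \<Sum>b<n. \<Sum>c<m. if a = c then (\<Sum>d<n. cnj (?v a b) * Y $$ (b,d) * ?v c d) else 0)"
      by (intro sum.cong HOL.refl) simp
    also have "\<dots> = (\<Sum>a<m. \<Sum>b<n. \<Sum>d<n. cnj (?v a b) * Y $$ (b,d) * ?v a d)"
      by simp
    finally have "Re (\<Sum>i<m * n. \<Sum>j<m * n. cnj (v i) * ham_comp X Y $$ (i,j) * v j)
      = (\<Sum>b<n. Re (\<Sum>a<m. \<Sum>c<m. cnj (?v a b) * X $$ (a,c) * ?v c b))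
       + (\<Sum>a<m. Re (\<Sum>b<n. \<Sum>d<n. cnj (?v a b) * Y $$ (b,d) * ?v a d))"
      by (simp only: plus_complex.sel Re_sum)
    moreover have "0 \<le> Re (\<Sum>a<m. \<Sum>c<m. cnj (?v a b) * X $$ (a,c) * ?v c b)" for b
      using psdX[of "\<lambda>a. ?v a b"] .
    moreover have "0 \<le> Re (\<Sum>b<n. \<Sum>d<n. cnj (?v a b) * Y $$ (b,d) * ?v a d)" for a
      using psdY[of "?v a"] .
    ultimately show ?thesis by (simp only: add_nonneg_nonneg sum_nonneg)
  qed
  ultimately show ?thesis
    using X Y hX hY by (simp add: is_hamiltonian_def)
qed

section \<open>Gibbs states\<close>

lemma smult_pow_mat:
  fixes H :: "'a :: comm_semiring_1 mat"
  assumes "H \<in> carrier_mat n n"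
  shows "(a \<cdot>\<^sub>m H) ^\<^sub>m k = a ^ k \<cdot>\<^sub>m (H ^\<^sub>m k)"
proof (induction k)
  case 0
  then show ?case by (intro eq_matI) auto
next
  case (Suc k)
  have "H ^\<^sub>m k \<in> carrier_mat n n" using assms by simp
  then have "(a ^ k \<cdot>\<^sub>m (H ^\<^sub>m k)) * (a \<cdot>\<^sub>m H) = (a ^ k * a) \<cdot>\<^sub>m (H ^\<^sub>m k * H)"
    using assms
    by (intro eq_matI) (auto simp: scalar_prod_def sum_distrib_left algebra_simps intro!: sum.cong)
  then show ?case using Suc by (simp add: mult.commute)
qed

lemma pow_mat_add:
  fixes H :: "'a :: semiring_1 mat"
  assumes "H \<in> carrier_mat n n"
  shows "H ^\<^sub>m (j + k) = H ^\<^sub>m j * H ^\<^sub>m k"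
proof (induction k)
  case 0
  show ?case using assms by (simp add: right_mult_one_mat[of _ n n])
next
  case (Suc k)
  then show ?case using assms by (simp add: assoc_mult_mat[of _ n n _ n _ n])
qed

lemma pow_mat_hermitian:
  assumes "H \<in> carrier_mat n n" "cadj H = H"
  shows "cadj (H ^\<^sub>m k) = H ^\<^sub>m k"
proof (induction k)
  case (Suc k)
  have "cadj (H ^\<^sub>m Suc k) = H * H ^\<^sub>m k"
    using assms Suc by (simp add: cadj_mult[of _ n n _ n])
  also have "\<dots> = H ^\<^sub>m Suc k"
    using pow_mat_add[OF assms(1), of 1 k] assms(1) by (simp add: left_mult_one_mat[of _ n n])
  finally show ?case .
qed simp

text \<open>A further factor \<open>H\<close> enlarges the entry bound by at most a column sum of
  moduli, and \<open>B\<close>, the sum of the moduli of all entries, dominates every column sum.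
  Geometric growth is enough, since the exponential series divides by factorials.\<close>

lemma pow_mat_entry_bound:
  fixes H :: "complex mat"
  assumes H: "H \<in> carrier_mat n n"
  shows "\<exists>B\<ge>0. \<forall>k i j. i < n \<longrightarrow> j < n \<longrightarrow> cmod ((H ^\<^sub>m k) $$ (i,j)) \<le> B ^ k"
proof -
  define B where "B = (\<Sum>j<n. \<Sum>i<n. cmod (H $$ (i,j)))"
  have B0: "B \<ge> 0" by (simp add: B_def sum_nonneg)
  have "i < n \<Longrightarrow> j < n \<Longrightarrow> cmod ((H ^\<^sub>m k) $$ (i,j)) \<le> B ^ k" for k i j
  proof (induction k arbitrary: i j)
    case 0
    then show ?case using H by auto
  next
    case (Suc k)
    have "(\<Sum>l<n. cmod (H $$ (l,j))) \<le> B"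
      unfolding B_def by (rule member_le_sum[of j "{..<n}" "\<lambda>j. \<Sum>i<n. cmod (H $$ (i,j))"])
        (use Suc.prems in \<open>auto intro: sum_nonneg\<close>)
    moreover have "cmod ((H ^\<^sub>m Suc k) $$ (i,j)) \<le> (\<Sum>l<n. cmod ((H ^\<^sub>m k) $$ (i,l)) * cmod (H $$ (l,j)))"
      using mult_index[of "H ^\<^sub>m k" n n H n i j] H Suc.prems
      by (simp add: norm_mult[symmetric] norm_sum)
    moreover have "\<dots> \<le> (\<Sum>l<n. B ^ k * cmod (H $$ (l,j)))"
      using Suc by (intro sum_mono mult_right_mono) auto
    ultimately have "cmod ((H ^\<^sub>m Suc k) $$ (i,j)) \<le> B ^ k * (\<Sum>l<n. cmod (H $$ (l,j)))"
      by (simp add: sum_distrib_left)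
    also have "\<dots> \<le> B ^ k * B"
      using B0 \<open>(\<Sum>l<n. cmod (H $$ (l,j))) \<le> B\<close> by (intro mult_left_mono) auto
    finally show ?case by (simp add: mult.commute)
  qed
  then show ?thesis using B0 by blast
qed

text \<open>Absolute convergence, rather than mere convergence, is what the Cauchy product in
  \<open>mexp_add\<close> requires.\<close>

lemma mexp_entry_summable:
  fixes H :: "complex mat"
  assumes H: "H \<in> carrier_mat n n" and ij: "i < n" "j < n"
  shows "summable (\<lambda>k. norm ((H ^\<^sub>m k) $$ (i,j) / of_nat (fact k)))"
proof -
  obtain B where B: "B \<ge> 0" "\<And>k i j. i < n \<Longrightarrow> j < n \<Longrightarrow> cmod ((H ^\<^sub>m k) $$ (i,j)) \<le> B ^ k"
    using pow_mat_entry_bound[OF H] by blast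
  have "summable (\<lambda>k. B ^ k / fact k)"
    using summable_exp[of B] by (simp add: field_simps)
  then show ?thesis
    by (rule summable_comparison_test'[where N = 0])
      (use B ij in \<open>auto simp: norm_divide intro!: divide_right_mono\<close>)
qed

lemma mexp_carrier [simp]: "M \<in> carrier_mat n n \<Longrightarrow> mexp M \<in> carrier_mat n n"
  unfolding carrier_mat_def by (simp add: mexp_def)

lemma mexp_index:
  "M \<in> carrier_mat n n \<Longrightarrow> i < n \<Longrightarrow> j < n \<Longrightarrow>
    mexp M $$ (i,j) = (\<Sum>k. (M ^\<^sub>m k) $$ (i,j) / of_nat (fact k))"
  by (simp add: mexp_def)

text \<open>Both exponents are multiples of the same matrix, so in the Cauchy product the scalar
  coefficients separate from the power \<open>H ^\<^sub>m N\<close>. The lemma provides the square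
  root and the inverse of an exponential.\<close>

lemma mexp_add:
  assumes H: "H \<in> carrier_mat n n"
  shows "mexp (s \<cdot>\<^sub>m H) * mexp (t \<cdot>\<^sub>m H) = mexp ((s + t) \<cdot>\<^sub>m H)"
proof (rule eq_matI)
  have c: "a \<cdot>\<^sub>m H \<in> carrier_mat n n" for a using H by simp
  fix i j assume "i < dim_row (mexp ((s + t) \<cdot>\<^sub>m H))" "j < dim_col (mexp ((s + t) \<cdot>\<^sub>m H))"
  then have ij: "i < n" "j < n" using carrier_matD[OF mexp_carrier[OF c]] by simp_all
  have pow: "((a \<cdot>\<^sub>m H) ^\<^sub>m k) $$ (p,q) = a ^ k * (H ^\<^sub>m k) $$ (p,q)" if "p < n" "q < n" for a p q k
    using that H by (simp add: smult_pow_mat[OF H])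
  let ?f = "\<lambda>a p q k. ((a \<cdot>\<^sub>m H) ^\<^sub>m k) $$ (p,q) / of_nat (fact k)"
  have "(\<lambda>N. \<Sum>l<n. \<Sum>k\<le>N. ?f s i l k * ?f t l j (N - k)) sums
     (\<Sum>l<n. (\<Sum>k. ?f s i l k) * (\<Sum>k. ?f t l j k))"
    by (intro sums_sum Cauchy_product_sums mexp_entry_summable[OF c]) (use ij in auto)
  also have "(\<Sum>l<n. (\<Sum>k. ?f s i l k) * (\<Sum>k. ?f t l j k)) = (mexp (s \<cdot>\<^sub>m H) * mexp (t \<cdot>\<^sub>m H)) $$ (i,j)"
    by (simp add: mult_index[OF mexp_carrier[OF c] mexp_carrier[OF c] ij] mexp_index[OF c] ij)
  also have "(\<lambda>N. \<Sum>l<n. \<Sum>k\<le>N. ?f s i l k * ?f t l j (N - k)) = ?f (s + t) i j"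
  proof
    fix N
    have "(\<Sum>l<n. \<Sum>k\<le>N. ?f s i l k * ?f t l j (N - k))
       = (\<Sum>k\<le>N. \<Sum>l<n. (s ^ k /\<^sub>R fact k * (t ^ (N - k) /\<^sub>R fact (N - k))) * ((H ^\<^sub>m k) $$ (i,l) * (H ^\<^sub>m (N - k)) $$ (l,j)))"
      by (subst sum.swap, intro sum.cong HOL.refl) (simp add: pow ij scaleR_conv_of_real field_simps)
    also have "\<dots> = (\<Sum>k\<le>N. (s ^ k /\<^sub>R fact k * (t ^ (N - k) /\<^sub>R fact (N - k))) * (H ^\<^sub>m N) $$ (i,j))"
    proof (intro sum.cong HOL.refl)
      fix k assume "k \<in> {..N}"
      then have "(H ^\<^sub>m N) $$ (i,j) = (\<Sum>l<n. (H ^\<^sub>m k) $$ (i,l) * (H ^\<^sub>m (N - k)) $$ (l,j))"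
        using pow_mat_add[OF H, of k "N - k"] mult_index[of "H ^\<^sub>m k" n n "H ^\<^sub>m (N - k)" n i j] H ij by simp
      then show "(\<Sum>l<n. (s ^ k /\<^sub>R fact k * (t ^ (N - k) /\<^sub>R fact (N - k))) * ((H ^\<^sub>m k) $$ (i,l) * (H ^\<^sub>m (N - k)) $$ (l,j)))
         = (s ^ k /\<^sub>R fact k * (t ^ (N - k) /\<^sub>R fact (N - k))) * (H ^\<^sub>m N) $$ (i,j)"
        by (simp only: sum_distrib_left)
    qed
    \<comment> \<open>Only scalars depend on \<open>k\<close> now, and this is the binomial theorem
      for the commuting numbers \<open>s\<close> and \<open>t\<close>.\<close>
    also have "\<dots> = ((s + t) ^ N /\<^sub>R fact N) * (H ^\<^sub>m N) $$ (i,j)"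
      by (simp only: exp_series_add_commuting[OF mult.commute] sum_distrib_right)
    also have "\<dots> = ?f (s + t) i j N"
      by (simp add: pow ij scaleR_conv_of_real field_simps)
    finally show "(\<Sum>l<n. \<Sum>k\<le>N. ?f s i l k * ?f t l j (N - k)) = ?f (s + t) i j N" .
  qed
  finally show "(mexp (s \<cdot>\<^sub>m H) * mexp (t \<cdot>\<^sub>m H)) $$ (i,j) = mexp ((s + t) \<cdot>\<^sub>m H) $$ (i,j)"
    by (simp add: mexp_index[OF c ij] sums_iff)
qed (use H in \<open>auto simp: mexp_def\<close>)

lemma mexp_zero: "mexp (0\<^sub>m n n) = 1\<^sub>m n"
proof (rule eq_matI)
  fix i j assume "i < dim_row (1\<^sub>m n)" "j < dim_col (1\<^sub>m n)"
  then have ij: "i < n" "j < n" by auto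
  have "((0\<^sub>m n n) ^\<^sub>m k) $$ (i,j) / of_nat (fact k) = (if k = 0 then 1\<^sub>m n $$ (i,j) else 0 :: complex)" for k
    using ij by (cases k) auto
  then have "mexp (0\<^sub>m n n) $$ (i,j) = (\<Sum>k. if k = 0 then 1\<^sub>m n $$ (i,j) else 0)"
    by (simp add: mexp_index[OF zero_carrier_mat ij])
  then show "mexp (0\<^sub>m n n) $$ (i,j) = 1\<^sub>m n $$ (i,j)"
    using sums_unique[OF sums_single[of 0 "\<lambda>_. 1\<^sub>m n $$ (i,j) :: complex"]] by simp
qed (auto simp: mexp_def)

lemma cadj_mexp:
  assumes H: "H \<in> carrier_mat n n" and "cadj H = H"
  shows "cadj (mexp (complex_of_real t \<cdot>\<^sub>m H)) = mexp (complex_of_real t \<cdot>\<^sub>m H)"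
proof (rule eq_matI)
  let ?M = "complex_of_real t \<cdot>\<^sub>m H"
  have M: "?M \<in> carrier_mat n n" using H by simp
  have "cadj ?M = ?M"
  proof (rule eq_matI)
    fix i j assume "i < dim_row ?M" "j < dim_col ?M"
    moreover from this have "cnj (H $$ (j,i)) = H $$ (i,j)"
      using H cadj_index[of i H j] assms(2) by simp
    ultimately show "cadj ?M $$ (i,j) = ?M $$ (i,j)" using H by simp
  qed (use H in auto)
  note herm = pow_mat_hermitian[OF M this]
  fix i j assume "i < dim_row (mexp ?M)" "j < dim_col (mexp ?M)"
  then have ij: "i < n" "j < n" using mexp_carrier[OF M] by auto
  have "cnj (mexp ?M $$ (j,i)) = (\<Sum>k. cnj ((?M ^\<^sub>m k) $$ (j,i) / of_nat (fact k)))"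
    unfolding mexp_index[OF M ij(2,1)]
    by (rule bounded_linear.suminf[OF bounded_linear_cnj]) (rule summable_norm_cancel[OF mexp_entry_summable[OF M ij(2,1)]])
  also have "\<dots> = mexp ?M $$ (i,j)"
  proof -
    have "cadj (?M ^\<^sub>m k) $$ (i,j) = cnj ((?M ^\<^sub>m k) $$ (j,i))" for k
      by (rule cadj_index) (simp_all only: carrier_matD[OF pow_carrier_mat[OF M]] ij)
    then have "cnj ((?M ^\<^sub>m k) $$ (j,i)) = (?M ^\<^sub>m k) $$ (i,j)" for k
      by (simp only: herm)
    then show ?thesis by (simp add: mexp_index[OF M ij])
  qed
  finally show "cadj (mexp ?M) $$ (i,j) = mexp ?M $$ (i,j)"
    using ij mexp_carrier[OF M] by simp
qed (use H in \<open>auto simp: mexp_def\<close>)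

text \<open>The trace is the squared Frobenius norm of the invertible Hermitian matrix \<open>exp (t H / 2)\<close>.\<close>
lemma mtrace_mexp_nonzero:
  assumes "is_hamiltonian H"
  shows "mtrace (mexp (complex_of_real t \<cdot>\<^sub>m H)) \<noteq> 0"
proof
  define n where "n = dim_row H"
  have H: "H \<in> carrier_mat n n" "cadj H = H" "0 < n"
    using assms unfolding n_def is_hamiltonian_def carrier_mat_def by simp_all
  define B where "B = mexp (complex_of_real (t/2) \<cdot>\<^sub>m H)"
  have B: "B \<in> carrier_mat n n" using H by (simp add: B_def)
  have "B * B = mexp ((complex_of_real (t/2) + complex_of_real (t/2)) \<cdot>\<^sub>m H)"
    unfolding B_def by (rule mexp_add[OF H(1)])
  also have "complex_of_real (t/2) + complex_of_real (t/2) = complex_of_real t"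
    by (simp flip: of_real_add)
  finally have BB: "B * B = mexp (complex_of_real t \<cdot>\<^sub>m H)" .
  have cB: "cadj B = B"
    unfolding B_def by (rule cadj_mexp[OF H(1,2)])
  have herm: "B $$ (j,i) = cnj (B $$ (i,j))" if "i < n" "j < n" for i j
  proof -
    have "cadj B $$ (j,i) = cnj (B $$ (i,j))" by (rule cadj_index) (use that B in auto)
    then show ?thesis by (simp only: cB)
  qed
  have sq: "B $$ (i,j) * B $$ (j,i) = of_real ((cmod (B $$ (i,j)))\<^sup>2)" if "i < n" "j < n" for i j
    by (simp only: herm[OF that] complex_norm_square)
  have "dim_row (B * B) = n" using B by simp
  then have "mtrace (B * B) = (\<Sum>i<n. (B * B) $$ (i,i))" by (simp only: mtrace_def)
  also have "\<dots> = (\<Sum>i<n. \<Sum>j<n. B $$ (i,j) * B $$ (j,i))"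
    by (intro sum.cong HOL.refl) (simp only: mult_index[OF B B] lessThan_iff)
  also have "\<dots> = of_real (\<Sum>i<n. \<Sum>j<n. (cmod (B $$ (i,j)))\<^sup>2)"
    unfolding of_real_sum
    by (intro sum.cong HOL.refl) (simp only: sq lessThan_iff)
  finally have tr: "mtrace (B * B) = of_real (\<Sum>i<n. \<Sum>j<n. (cmod (B $$ (i,j)))\<^sup>2)" .
  assume "mtrace (mexp (complex_of_real t \<cdot>\<^sub>m H)) = 0"
  then have "(\<Sum>i<n. \<Sum>j<n. (cmod (B $$ (i,j)))\<^sup>2) = 0"
    unfolding BB[symmetric] tr of_real_eq_0_iff .
  then have "\<forall>i<n. \<forall>j<n. B $$ (i,j) = 0"
    by (simp add: sum_nonneg_eq_0_iff sum_nonneg)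
  then have Z: "B = 0\<^sub>m n n" using B by (intro eq_matI) (simp_all add: carrier_matD)
  have E: "mexp (complex_of_real (- (t/2)) \<cdot>\<^sub>m H) \<in> carrier_mat n n"
    by (rule mexp_carrier, rule smult_carrier_mat, rule H(1))
  have I: "B * mexp (complex_of_real (- (t/2)) \<cdot>\<^sub>m H) = 1\<^sub>m n"
  proof -
    have "0 \<cdot>\<^sub>m H = 0\<^sub>m n n" using H(1) by (intro eq_matI) auto
    then show ?thesis
      unfolding B_def mexp_add[OF H(1)] by (simp only: of_real_minus add.right_inverse mexp_zero)
  qed
  have "0\<^sub>m n n = (1\<^sub>m n :: complex mat)"
    using left_mult_zero_mat[OF E, of n] I by (simp only: Z)
  then have "(0\<^sub>m n n :: complex mat) $$ (0,0) = 1\<^sub>m n $$ (0,0)" by (rule arg_cong)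
  then show False using H(3) by simp
qed

lemma gibbs_carrier [simp]: "H \<in> carrier_mat n n \<Longrightarrow> gibbs \<beta> H \<in> carrier_mat n n"
  by (simp add: gibbs_def)

lemma mtrace_smult: "M \<in> carrier_mat n n \<Longrightarrow> mtrace (a \<cdot>\<^sub>m M) = a * mtrace M"
  by (simp add: mtrace_def sum_distrib_left)

text \<open>The partition function must be nonzero: with value 0 the quotient in
  \<open>gibbs\<close> would be 0 by convention, and so would the trace. Trace 1 is what makes a
  discarded Gibbs state disappear from a partial trace.\<close>

lemma mtrace_gibbs:
  assumes "is_hamiltonian H"
  shows "mtrace (gibbs \<beta> H) = 1"
  unfolding gibbs_def mtrace_smult[OF mexp_carrier[OF smult_carrier_mat[OF is_hamiltonian_carrier[OF assms]]]]
  using mtrace_mexp_nonzero[OF assms, of "- \<beta>"] by simp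

lemma gibbs_zero: "gibbs \<beta> (0\<^sub>m n n) = (1 / of_nat n) \<cdot>\<^sub>m 1\<^sub>m n"
  by (simp add: gibbs_def mexp_zero mtrace_def)

section \<open>Energy-conserving unitaries\<close>

lemma one_smult_mat: "(1 :: complex) \<cdot>\<^sub>m M = M"
  by (intro eq_matI) auto

lemma is_unitary_iff:
  "V \<in> carrier_mat n n \<Longrightarrow> is_unitary V \<longleftrightarrow> V * cadj V = 1\<^sub>m n \<and> cadj V * V = 1\<^sub>m n"
  by (auto simp: is_unitary_def)

text \<open>Two Hamiltonians are allowed because a dilation changes the factorisation of the system,
  from \<open>X \<otimes> C\<close> to \<open>L \<otimes> Y\<close>. For \<open>P = Q\<close> this
  is the condition on the unitary of an elementary step.\<close>

definition conserves :: "nat \<Rightarrow> complex mat \<Rightarrow> complex mat \<Rightarrow> complex mat \<Rightarrow> bool" where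
  "conserves n P Q V \<longleftrightarrow> P \<in> carrier_mat n n \<and> Q \<in> carrier_mat n n \<and> V \<in> carrier_mat n n \<and>
     V * cadj V = 1\<^sub>m n \<and> cadj V * V = 1\<^sub>m n \<and> V * P = Q * V"

lemma mult4_mat:
  fixes A B C D :: "complex mat"
  assumes "A \<in> carrier_mat n n" "B \<in> carrier_mat n n" "C \<in> carrier_mat n n" "D \<in> carrier_mat n n"
  shows "(A * B) * (C * D) = A * (B * C) * D"
  using assms by (simp add: assoc_mult_mat[of _ n n _ n _ n])

lemma mult_conj:
  assumes "W \<in> carrier_mat n n" "V \<in> carrier_mat n n" "M \<in> carrier_mat n n"
  shows "(W * V) * M * cadj (W * V) = W * (V * M * cadj V) * cadj W"
proof -
  have "(W * V) * M * cadj (W * V) = (W * (V * M)) * (cadj V * cadj W)"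
    by (simp only: cadj_mult[OF assms(1,2)] assoc_mult_mat[OF assms])
  also have "\<dots> = W * ((V * M) * cadj V) * cadj W"
    by (rule mult4_mat[of _ n]) (use assms in auto)
  finally show ?thesis .
qed

lemma conserves_one: "P \<in> carrier_mat n n \<Longrightarrow> conserves n P P (1\<^sub>m n)"
  by (simp add: conserves_def)

lemma conserves_mult:
  assumes "conserves n P Q V" "conserves n Q R W"
  shows "conserves n P R (W * V)"
proof -
  have c: "P \<in> carrier_mat n n" "Q \<in> carrier_mat n n" "R \<in> carrier_mat n n" "V \<in> carrier_mat n n" "W \<in> carrier_mat n n"
    and V: "V * cadj V = 1\<^sub>m n" "cadj V * V = 1\<^sub>m n" "V * P = Q * V"
    and W: "W * cadj W = 1\<^sub>m n" "cadj W * W = 1\<^sub>m n" "W * Q = R * W"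
    using assms by (auto simp: conserves_def)
  have cd: "cadj (W * V) = cadj V * cadj W" by (rule cadj_mult[OF c(5,4)])
  have "(W * V) * (cadj V * cadj W) = 1\<^sub>m n"
    by (subst mult4_mat[of _ n]) (use c V W in auto)
  moreover have "(cadj V * cadj W) * (W * V) = 1\<^sub>m n"
    by (subst mult4_mat[of _ n]) (use c V W in auto)
  moreover have "(W * V) * P = R * (W * V)"
  proof -
    have "(W * V) * P = W * (Q * V)"
      using c V by (simp add: assoc_mult_mat[of _ n n _ n _ n])
    also have "\<dots> = (W * Q) * V"
      using c by (simp add: assoc_mult_mat[of _ n n _ n _ n])
    also have "\<dots> = R * (W * V)"
      unfolding W(3) using c by (simp add: assoc_mult_mat[of _ n n _ n _ n])
    finally show ?thesis .
  qed
  ultimately show ?thesis using c by (simp add: conserves_def cd)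
qed

text \<open>Multiply \<open>V * P = Q * V\<close> by the adjoint of \<open>V\<close> from both
  sides. Invertibility is what later allows a dilation to be undone at no energy cost.\<close>

lemma conserves_cadj:
  assumes "conserves n P Q V"
  shows "conserves n Q P (cadj V)"
proof -
  have c: "P \<in> carrier_mat n n" "Q \<in> carrier_mat n n" "V \<in> carrier_mat n n" "cadj V \<in> carrier_mat n n"
    and V: "V * cadj V = 1\<^sub>m n" "cadj V * V = 1\<^sub>m n" "V * P = Q * V"
    using assms by (auto simp: conserves_def)
  have "cadj V * Q = (cadj V * Q) * (V * cadj V)" using c V(1) by simp
  also have "\<dots> = cadj V * (Q * V) * cadj V" by (rule mult4_mat) (use c in auto)
  also have "\<dots> = cadj V * (V * P) * cadj V" by (simp only: V(3))
  also have "\<dots> = (cadj V * V) * (P * cadj V)" by (rule mult4_mat[symmetric]) (use c in auto)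
  also have "\<dots> = P * cadj V" using c V(2) by simp
  finally show ?thesis using c V by (simp add: conserves_def)
qed

lemma conserves_kron_left:
  assumes "conserves n P Q V" and D: "D \<in> carrier_mat d d"
  shows "conserves (n * d) (ham_comp P D) (ham_comp Q D) (kron V (1\<^sub>m d))"
proof -
  have c: "P \<in> carrier_mat n n" "Q \<in> carrier_mat n n" "V \<in> carrier_mat n n" "cadj V \<in> carrier_mat n n"
    and V: "V * cadj V = 1\<^sub>m n" "cadj V * V = 1\<^sub>m n" "V * P = Q * V"
    using assms by (auto simp: conserves_def)
  have "kron V (1\<^sub>m d) * ham_comp P D = kron (V * P) (1\<^sub>m d) + kron V D"
    unfolding ham_comp_def
    by (subst mult_add_distrib_mat[of _ "n * d" "n * d" _ "n * d"]) (use c D in \<open>auto simp: kron_mult[of _ n n _ d d _ n _ d]\<close>)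
  also have "\<dots> = ham_comp Q D * kron V (1\<^sub>m d)"
    unfolding ham_comp_def V(3)
    by (subst add_mult_distrib_mat[of _ "n * d" "n * d" _ _ "n * d"]) (use c D in \<open>auto simp: kron_mult[of _ n n _ d d _ n _ d]\<close>)
  finally show ?thesis
    using c D V by (simp add: conserves_def cadj_kron kron_mult[of _ n n _ d d _ n _ d])
qed

lemma conserves_kron_right:
  assumes "conserves n P Q V" and D: "D \<in> carrier_mat d d"
  shows "conserves (d * n) (ham_comp D P) (ham_comp D Q) (kron (1\<^sub>m d) V)"
proof -
  have c: "P \<in> carrier_mat n n" "Q \<in> carrier_mat n n" "V \<in> carrier_mat n n" "cadj V \<in> carrier_mat n n"
    and V: "V * cadj V = 1\<^sub>m n" "cadj V * V = 1\<^sub>m n" "V * P = Q * V"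
    using assms by (auto simp: conserves_def)
  have "kron (1\<^sub>m d) V * ham_comp D P = kron D V + kron (1\<^sub>m d) (V * P)"
    unfolding ham_comp_def
    by (subst mult_add_distrib_mat[of _ "d * n" "d * n" _ "d * n"]) (use c D in \<open>auto simp: kron_mult[of _ d d _ n n _ d _ n]\<close>)
  also have "\<dots> = ham_comp D Q * kron (1\<^sub>m d) V"
    unfolding ham_comp_def V(3)
    by (subst add_mult_distrib_mat[of _ "d * n" "d * n" _ _ "d * n"]) (use c D in \<open>auto simp: kron_mult[of _ d d _ n n _ d _ n]\<close>)
  finally show ?thesis
    using c D V by (simp add: conserves_def cadj_kron kron_mult[of _ d d _ n n _ d _ n])
qed

text \<open>Swapping the factors of an identity matrix leaves it fixed, which gives the first
  equation; a one-sided inverse of a square matrix is two-sided, which gives the second.\<close>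

lemma swap_mat_unitary:
  "swap_mat m n * cadj (swap_mat m n) = 1\<^sub>m (n * m)" "cadj (swap_mat m n) * swap_mat m n = 1\<^sub>m (n * m)"
proof -
  let ?S = "swap_mat m n"
  have c: "?S \<in> carrier_mat (n * m) (n * m)" "cadj ?S \<in> carrier_mat (n * m) (n * m)" by auto
  have "swap_sys m n (1\<^sub>m (n * m)) = 1\<^sub>m (n * m)"
    using swap_sys_kron[OF one_carrier_mat[of m] one_carrier_mat[of n]] by (simp add: mult.commute)
  then have "?S * 1\<^sub>m (n * m) * cadj ?S = 1\<^sub>m (n * m)"
    by (simp only: swap_mat_conj[OF one_carrier_mat])
  then show 1: "?S * cadj ?S = 1\<^sub>m (n * m)" by (simp only: right_mult_one_mat[OF c(1)])
  show "cadj ?S * ?S = 1\<^sub>m (n * m)" by (rule mat_mult_left_right_inverse[OF c 1])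
qed

lemma conserves_swap:
  assumes X: "X \<in> carrier_mat m m" and Y: "Y \<in> carrier_mat n n"
  shows "conserves (n * m) (ham_comp X Y) (ham_comp Y X) (swap_mat m n)"
proof -
  let ?S = "swap_mat m n"
  have c: "?S \<in> carrier_mat (n * m) (n * m)" "cadj ?S \<in> carrier_mat (n * m) (n * m)" by auto
  have XY: "ham_comp X Y \<in> carrier_mat (n * m) (n * m)" and YX: "ham_comp Y X \<in> carrier_mat (n * m) (n * m)"
    using ham_comp_carrier[OF X Y] ham_comp_carrier[OF Y X] by (simp_all add: mult.commute)
  have d: "dim_row X = m" "dim_row Y = n" using X Y by auto
  have "swap_sys m n (ham_comp X Y) = kron (1\<^sub>m n) X + kron Y (1\<^sub>m m)"
    unfolding ham_comp_def d
    by (subst swap_sys_add) (use X Y in \<open>auto simp: swap_sys_kron\<close>)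
  also have "\<dots> = ham_comp Y X"
    unfolding ham_comp_def d
    by (rule comm_add_mat[of _ "n * m" "n * m"]) (use X Y in auto)
  finally have "?S * ham_comp X Y * cadj ?S = ham_comp Y X"
    by (simp only: swap_mat_conj[OF XY])
  then have "ham_comp Y X * ?S = ?S * ham_comp X Y * cadj ?S * ?S" by (simp only:)
  also have "\<dots> = ?S * ham_comp X Y * (cadj ?S * ?S)"
    by (rule assoc_mult_mat[OF mult_carrier_mat[OF c(1) XY] c(2,1)])
  also have "\<dots> = ?S * ham_comp X Y"
    unfolding swap_mat_unitary by (rule right_mult_one_mat[OF mult_carrier_mat[OF c(1) XY]])
  finally show ?thesis using XY YX by (simp add: conserves_def swap_mat_unitary)
qed

lemma kron_conj_left:
  assumes "V \<in> carrier_mat n n" "M \<in> carrier_mat n n" "T \<in> carrier_mat d d"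
  shows "kron V (1\<^sub>m d) * kron M T * cadj (kron V (1\<^sub>m d)) = kron (V * M * cadj V) T"
  using assms by (simp add: cadj_kron kron_mult[of _ n n _ d d _ n _ d] mult_carrier_mat[of _ n n _ n])

lemma ptrace1_conj_right:
  assumes "W \<in> carrier_mat n n" "M \<in> carrier_mat (l * n) (l * n)"
  shows "ptrace1 l n (kron (1\<^sub>m l) W * M * cadj (kron (1\<^sub>m l) W)) = W * ptrace1 l n M * cadj W"
proof -
  have "kron (1\<^sub>m l) W \<in> carrier_mat (l * n) (l * n)" using assms by simp
  then show ?thesis
    using assms
    by (simp add: cadj_kron ptrace1_mult_right ptrace1_mult_left mult_carrier_mat[of _ "l * n" "l * n" _ "l * n"])
qed

text \<open>By cyclicity \<open>V\<close> meets its adjoint and cancels: a unitary on a subsystem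
  that is then discarded does not affect the rest.\<close>

lemma ptrace1_conj_left:
  assumes V: "V \<in> carrier_mat m m" "cadj V * V = 1\<^sub>m m" and M: "M \<in> carrier_mat (m * n) (m * n)"
  shows "ptrace1 m n (kron V (1\<^sub>m n) * M * cadj (kron V (1\<^sub>m n))) = ptrace1 m n M"
proof -
  let ?K = "kron V (1\<^sub>m n)"
  have K: "?K \<in> carrier_mat (m * n) (m * n)" "cadj ?K \<in> carrier_mat (m * n) (m * n)" using V by auto
  have KK: "cadj ?K * ?K = 1\<^sub>m (m * n)"
    using V by (simp add: cadj_kron kron_mult[of _ m m _ n n _ m _ n])
  have "ptrace1 m n (?K * M * cadj ?K) = ptrace1 m n (?K * (M * cadj ?K))"
    by (simp only: assoc_mult_mat[OF K(1) M K(2)])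
  also have "\<dots> = ptrace1 m n (M * cadj ?K * ?K)"
    by (rule ptrace1_kron_cyclic[OF V(1) mult_carrier_mat[OF M K(2)]])
  also have "M * cadj ?K * ?K = M"
    by (simp only: assoc_mult_mat[OF M K(2,1)] KK right_mult_one_mat[OF M])
  finally show ?thesis .
qed

section \<open>Thermal states and dilations\<close>

lemma thermal_op_trans:
  assumes "thermal_op \<beta> Y Z g" "thermal_op \<beta> X Y f"
  shows "thermal_op \<beta> X Z (g \<circ> f)"
  using assms
proof (induction arbitrary: f rule: thermal_op.induct)
  case (refl Y)
  then show ?case by (simp add: comp_def)
next
  case (step Y W g Z h)
  show ?case using thermal_op.step[OF step.IH[OF step.prems] step.hyps(2)] by (simp only: comp_assoc)
qed

lemma thermal_op_elem_step: "is_hamiltonian X \<Longrightarrow> elem_step \<beta> X Y f \<Longrightarrow> thermal_op \<beta> X Y f"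
  using thermal_op.step[OF thermal_op.refl[of X \<beta>], of Y f] by (simp add: comp_def)

text \<open>Tensor products of Gibbs states satisfy this without having to be identified with the
  Gibbs state of the composite system.\<close>
definition thermal_state :: "real \<Rightarrow> complex mat \<Rightarrow> complex mat \<Rightarrow> bool" where
  "thermal_state \<beta> C s \<longleftrightarrow> is_hamiltonian C \<and> s \<in> carrier_mat (dim_row C) (dim_row C) \<and> mtrace s = 1 \<and>
     (\<forall>X. is_hamiltonian X \<longrightarrow> (\<exists>F. thermal_op \<beta> X (ham_comp X C) F \<and>
        (\<forall>\<rho> \<in> carrier_mat (dim_row X) (dim_row X). F \<rho> = kron \<rho> s)))"

lemma thermal_state_gibbs:
  assumes "is_hamiltonian C"
  shows "thermal_state \<beta> C (gibbs \<beta> C)"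
  unfolding thermal_state_def
proof (intro conjI allI impI)
  fix X assume "is_hamiltonian X"
  then show "\<exists>F. thermal_op \<beta> X (ham_comp X C) F \<and>
        (\<forall>\<rho> \<in> carrier_mat (dim_row X) (dim_row X). F \<rho> = kron \<rho> (gibbs \<beta> C))"
    using thermal_op_elem_step[OF _ append_right[OF _ assms]] by blast
qed (rule assms gibbs_carrier[OF is_hamiltonian_carrier[OF assms]] mtrace_gibbs[OF assms])+

lemma mtrace_kron:
  assumes A: "A \<in> carrier_mat m m" and B: "B \<in> carrier_mat n n"
  shows "mtrace (kron A B) = mtrace A * mtrace B"
proof -
  have "mtrace (kron A B) = (\<Sum>i<m * n. kron A B $$ (i,i))" using A B by (simp add: mtrace_def)
  also have "\<dots> = (\<Sum>a<m. \<Sum>b<n. A $$ (a,a) * B $$ (b,b))"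
    unfolding sum_prod_index by (intro sum.cong HOL.refl) (simp add: kron_pair_index[OF A B])
  finally show ?thesis using A B by (simp add: mtrace_def sum_product)
qed

text \<open>Append \<open>C\<close>, then \<open>D\<close>; strict associativity identifies the
  result with appending the composite ancilla in one go.\<close>

lemma thermal_state_kron:
  assumes C: "thermal_state \<beta> C s" and D: "thermal_state \<beta> D t"
  shows "thermal_state \<beta> (ham_comp C D) (kron s t)"
proof -
  have hC: "is_hamiltonian C" and hD: "is_hamiltonian D"
    and s: "s \<in> carrier_mat (dim_row C) (dim_row C)" "mtrace s = 1"
    and t: "t \<in> carrier_mat (dim_row D) (dim_row D)" "mtrace t = 1"
    using C D by (simp_all only: thermal_state_def)
  have "\<exists>F. thermal_op \<beta> X (ham_comp X (ham_comp C D)) F \<and>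
        (\<forall>\<rho> \<in> carrier_mat (dim_row X) (dim_row X). F \<rho> = kron \<rho> (kron s t))"
    if hX: "is_hamiltonian X" for X
  proof -
    obtain F where F: "thermal_op \<beta> X (ham_comp X C) F"
      "\<And>\<rho>. \<rho> \<in> carrier_mat (dim_row X) (dim_row X) \<Longrightarrow> F \<rho> = kron \<rho> s"
      using C hX unfolding thermal_state_def by metis
    have "\<exists>G. thermal_op \<beta> (ham_comp X C) (ham_comp (ham_comp X C) D) G \<and>
        (\<forall>\<rho> \<in> carrier_mat (dim_row (ham_comp X C)) (dim_row (ham_comp X C)). G \<rho> = kron \<rho> t)"
      using D is_hamiltonian_ham_comp[OF hX hC] unfolding thermal_state_def by blast
    then obtain G where G: "thermal_op \<beta> (ham_comp X C) (ham_comp (ham_comp X C) D) G"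
      "\<And>\<rho>. \<rho> \<in> carrier_mat (dim_row X * dim_row C) (dim_row X * dim_row C) \<Longrightarrow> G \<rho> = kron \<rho> t"
      unfolding dim_ham_comp(1) by blast
    have "(G \<circ> F) \<rho> = kron \<rho> (kron s t)" if "\<rho> \<in> carrier_mat (dim_row X) (dim_row X)" for \<rho>
      using F(2)[OF that] G(2)[OF kron_carrier[OF that s(1)]] by (simp add: kron_assoc)
    moreover have "thermal_op \<beta> X (ham_comp X (ham_comp C D)) (G \<circ> F)"
      using thermal_op_trans[OF G(1) F(1)]
      by (simp only: ham_comp_assoc[OF hX[THEN is_hamiltonian_carrier] hC[THEN is_hamiltonian_carrier] hD[THEN is_hamiltonian_carrier]])
    ultimately show ?thesis by blast
  qed
  then show ?thesis
    unfolding thermal_state_def dim_ham_comp(1) mtrace_kron[OF s(1) t(1)] s(2) t(2)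
    using is_hamiltonian_ham_comp[OF hC hD] kron_carrier[OF s(1) t(1)] by (simp only: mult_1 HOL.simp_thms) blast
qed

text \<open>The one-dimensional system of zero energy is neutral for \<open>ham_comp\<close>. It
  stands in for the ancilla of steps that append nothing.\<close>

lemma thermal_state_trivial: "thermal_state \<beta> (0\<^sub>m (Suc 0) (Suc 0)) (1\<^sub>m (Suc 0))"
proof -
  have "gibbs \<beta> (0\<^sub>m (Suc 0) (Suc 0)) = 1\<^sub>m (Suc 0)"
    unfolding gibbs_zero by (intro eq_matI) auto
  then show ?thesis
    using thermal_state_gibbs[OF is_hamiltonian_zero[of "Suc 0"], of \<beta>] by simp
qed

text \<open>The ancilla is appended on the right and the environment is discarded on the left, so that
  dilations compose without any reordering of tensor factors.\<close>
definition dilates :: "real \<Rightarrow> complex mat \<Rightarrow> complex mat \<Rightarrow> (complex mat \<Rightarrow> complex mat) \<Rightarrow>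
    complex mat \<Rightarrow> complex mat \<Rightarrow> complex mat \<Rightarrow> complex mat \<Rightarrow> bool" where
  "dilates \<beta> X Y f C s L V \<longleftrightarrow> is_hamiltonian X \<and> is_hamiltonian Y \<and> is_hamiltonian L \<and> thermal_state \<beta> C s \<and>
     conserves (dim_row X * dim_row C) (ham_comp X C) (ham_comp L Y) V \<and>
     (\<forall>\<rho> \<in> carrier_mat (dim_row X) (dim_row X).
        f \<rho> = ptrace1 (dim_row L) (dim_row Y) (V * kron \<rho> s * cadj V))"

text \<open>Names the dimensions and exposes the balance \<open>x * c = l * y\<close>, which is
  hidden in the carrier conditions of \<open>conserves\<close>.\<close>

lemma dilatesE:
  assumes "dilates \<beta> X Y f C s L V"
  obtains x y c l where
    "dim_row X = x" "dim_row Y = y" "dim_row C = c" "dim_row L = l"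
    "X \<in> carrier_mat x x" "Y \<in> carrier_mat y y" "C \<in> carrier_mat c c" "L \<in> carrier_mat l l"
    "is_hamiltonian X" "is_hamiltonian Y" "is_hamiltonian C" "is_hamiltonian L"
    "thermal_state \<beta> C s" "s \<in> carrier_mat c c" "x * c = l * y"
    "conserves (x * c) (ham_comp X C) (ham_comp L Y) V"
    "\<And>\<rho>. \<rho> \<in> carrier_mat x x \<Longrightarrow> f \<rho> = ptrace1 l y (V * kron \<rho> s * cadj V)"
proof -
  have h: "is_hamiltonian X" "is_hamiltonian Y" "is_hamiltonian C" "is_hamiltonian L"
    and s: "thermal_state \<beta> C s" "s \<in> carrier_mat (dim_row C) (dim_row C)"
    and V: "conserves (dim_row X * dim_row C) (ham_comp X C) (ham_comp L Y) V"
    using assms unfolding dilates_def thermal_state_def by blast+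
  have "ham_comp L Y \<in> carrier_mat (dim_row X * dim_row C) (dim_row X * dim_row C)"
    using V by (simp only: conserves_def)
  from carrier_matD(1)[OF this] have "dim_row X * dim_row C = dim_row L * dim_row Y" by simp
  with h s V assms show thesis
    by (intro that[OF HOL.refl HOL.refl HOL.refl HOL.refl]) (simp_all only: is_hamiltonian_carrier dilates_def)
qed

text \<open>The second ancilla \<open>D\<close> is appended before the first environment
  \<open>L\<close> is discarded. On \<open>L \<otimes> Y \<otimes> D\<close> the unitary
  \<open>W\<close> acts entirely to the right of \<open>L\<close>, so the discard of
  \<open>L\<close> moves past it and merges with the discard of \<open>M\<close>.\<close>

lemma dilates_comp:
  assumes f: "dilates \<beta> X Y f C s L V" and g: "dilates \<beta> Y Z g D t M W"
  shows "dilates \<beta> X Z (g \<circ> f) (ham_comp C D) (kron s t) (ham_comp L M)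
    (kron (1\<^sub>m (dim_row L)) W * kron V (1\<^sub>m (dim_row D)))"
proof -
  obtain x y c l where dims: "dim_row X = x" "dim_row Y = y" "dim_row C = c" "dim_row L = l"
    and cf: "X \<in> carrier_mat x x" "Y \<in> carrier_mat y y" "C \<in> carrier_mat c c" "L \<in> carrier_mat l l"
    and hf: "is_hamiltonian X" "is_hamiltonian Y" "is_hamiltonian C" "is_hamiltonian L"
    and s: "thermal_state \<beta> C s" "s \<in> carrier_mat c c" and xc: "x * c = l * y"
    and V: "conserves (x * c) (ham_comp X C) (ham_comp L Y) V"
    and fV: "\<And>\<rho>. \<rho> \<in> carrier_mat x x \<Longrightarrow> f \<rho> = ptrace1 l y (V * kron \<rho> s * cadj V)"
    by (rule dilatesE[OF f]) blast
  obtain y' z d m where dims': "dim_row Y = y'" "dim_row Z = z" "dim_row D = d" "dim_row M = m"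
    and cg: "Z \<in> carrier_mat z z" "D \<in> carrier_mat d d" "M \<in> carrier_mat m m"
    and hg: "is_hamiltonian Z" "is_hamiltonian D" "is_hamiltonian M"
    and t: "thermal_state \<beta> D t" "t \<in> carrier_mat d d" and yd: "y' * d = m * z"
    and W: "conserves (y' * d) (ham_comp Y D) (ham_comp M Z) W"
    and gW: "\<And>\<rho>. \<rho> \<in> carrier_mat y' y' \<Longrightarrow> g \<rho> = ptrace1 m z (W * kron \<rho> t * cadj W)"
    by (rule dilatesE[OF g]) blast
  have [simp]: "y' = y" using dims dims' by simp
  let ?V = "kron V (1\<^sub>m d)" and ?W = "kron (1\<^sub>m l) W"
  have n: "x * (c * d) = x * c * d" "l * (y * d) = x * c * d" by (simp_all add: xc mult.assoc)
  have "conserves (x * (c * d)) (ham_comp X (ham_comp C D)) (ham_comp L (ham_comp Y D)) ?V"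
    using conserves_kron_left[OF V cg(2)]
    by (simp only: n ham_comp_assoc[OF cf(1,3) cg(2)] ham_comp_assoc[OF cf(4,2) cg(2)])
  moreover have "conserves (x * (c * d)) (ham_comp L (ham_comp Y D)) (ham_comp (ham_comp L M) Z) ?W"
    using conserves_kron_right[OF W cf(4)]
    by (simp only: n \<open>y' = y\<close> ham_comp_assoc[OF cf(4) cg(3,1)])
  ultimately have "conserves (x * (c * d)) (ham_comp X (ham_comp C D)) (ham_comp (ham_comp L M) Z) (?W * ?V)"
    by (rule conserves_mult)
  moreover have "(g \<circ> f) \<rho> = ptrace1 (l * m) z (?W * ?V * kron \<rho> (kron s t) * cadj (?W * ?V))"
    if \<rho>: "\<rho> \<in> carrier_mat x x" for \<rho>
  proof -
    have Vc: "V \<in> carrier_mat (x * c) (x * c)" and Wc: "W \<in> carrier_mat (y * d) (y * d)"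
      using V W by (simp_all add: conserves_def)
    have rs: "kron \<rho> s \<in> carrier_mat (x * c) (x * c)" using \<rho> s by simp
    let ?A = "V * kron \<rho> s * cadj V"
    have A: "?A \<in> carrier_mat (l * y) (l * y)"
      unfolding xc[symmetric] by (intro mult_carrier_mat[of _ _ "x * c"] Vc rs cadj_carrier)
    have Vc': "?V \<in> carrier_mat (x * c * d) (x * c * d)" and Wc': "?W \<in> carrier_mat (x * c * d) (x * c * d)"
      using kron_carrier[OF Vc one_carrier_mat[of d]] kron_carrier[OF one_carrier_mat[of l] Wc] by (simp_all only: n)
    have At: "kron ?A t \<in> carrier_mat (l * (y * d)) (l * (y * d))"
      using kron_carrier[OF A t(2)] by (simp only: mult.assoc)
    have "?W * ?V * kron \<rho> (kron s t) * cadj (?W * ?V) = ?W * (?V * kron (kron \<rho> s) t * cadj ?V) * cadj ?W"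
      unfolding kron_assoc[symmetric] by (rule mult_conj[OF Wc' Vc' kron_carrier[OF rs t(2)]])
    also have "?V * kron (kron \<rho> s) t * cadj ?V = kron ?A t"
      by (rule kron_conj_left[OF Vc rs t(2)])
    finally have "ptrace1 (l * m) z (?W * ?V * kron \<rho> (kron s t) * cadj (?W * ?V))
       = ptrace1 m z (ptrace1 l (y * d) (?W * kron ?A t * cadj ?W))"
      using yd by (simp add: ptrace1_ptrace1)
    also have "ptrace1 l (y * d) (?W * kron ?A t * cadj ?W) = W * kron (ptrace1 l y ?A) t * cadj W"
      by (simp only: ptrace1_conj_right[OF Wc At] kron_ptrace1[OF A t(2)])
    also have "ptrace1 m z \<dots> = g (f \<rho>)"
      by (simp only: fV[OF \<rho>] gW[unfolded \<open>y' = y\<close>, OF ptrace1_carrier])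
    finally show ?thesis by simp
  qed
  ultimately show ?thesis
    unfolding dilates_def dim_ham_comp(1) dims dims'
    using hf hg is_hamiltonian_ham_comp[OF hf(4) hg(3)] thermal_state_kron[OF s(1) t(1)] by blast
qed

text \<open>Moving the ancilla to the environment side and discarding it leaves the input alone,
  because the ancilla has trace 1. Composition with this dilation pads any other one with an extra
  ancilla.\<close>

lemma dilates_swap:
  assumes hX: "is_hamiltonian X" and C: "thermal_state \<beta> C s"
  shows "dilates \<beta> X X (\<lambda>\<rho>. \<rho>) C s C (swap_mat (dim_row X) (dim_row C))"
proof -
  have hC: "is_hamiltonian C" and s: "s \<in> carrier_mat (dim_row C) (dim_row C)" "mtrace s = 1"
    using C by (simp_all only: thermal_state_def)
  have "\<rho> = ptrace1 (dim_row C) (dim_row X) (swap_mat (dim_row X) (dim_row C) * kron \<rho> s * cadj (swap_mat (dim_row X) (dim_row C)))"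
    if \<rho>: "\<rho> \<in> carrier_mat (dim_row X) (dim_row X)" for \<rho>
  proof -
    have "kron \<rho> s \<in> carrier_mat (dim_row C * dim_row X) (dim_row C * dim_row X)"
      using kron_carrier[OF \<rho> s(1)] by (simp only: mult.commute)
    then show ?thesis
      by (simp only: swap_mat_conj swap_sys_kron[OF \<rho> s(1)] ptrace1_kron[OF s(1) \<rho>] s(2) one_smult_mat)
  qed
  then show ?thesis
    unfolding dilates_def
    using hX hC C conserves_swap[OF is_hamiltonian_carrier[OF hX] is_hamiltonian_carrier[OF hC]]
    by (simp only: mult.commute HOL.simp_thms) blast
qed

lemma dilates_no_ancilla:
  assumes "is_hamiltonian X" "is_hamiltonian Y" "is_hamiltonian L"
    and "conserves (dim_row X) X (ham_comp L Y) V"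
    and "\<And>\<rho>. \<rho> \<in> carrier_mat (dim_row X) (dim_row X) \<Longrightarrow>
       f \<rho> = ptrace1 (dim_row L) (dim_row Y) (V * \<rho> * cadj V)"
  shows "dilates \<beta> X Y f (0\<^sub>m (Suc 0) (Suc 0)) (1\<^sub>m (Suc 0)) L V"
  unfolding dilates_def index_zero_mat(2) kron_one_one_right mult_Suc_right mult_0_right add_0_right
    ham_comp_trivial(1)[OF is_hamiltonian_carrier[OF assms(1)]]
  using assms thermal_state_trivial by blast

section \<open>Dilations of thermal operations\<close>

text \<open>Swaps repair the steps that append on the left or discard on the right, against the
  convention of \<open>dilates\<close>; a one-dimensional system fills the place of a missing
  ancilla or environment.\<close>

lemma elem_step_dilates:
  assumes "elem_step \<beta> X Y f"
  shows "\<exists>C s L V. dilates \<beta> X Y f C s L V"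
  using assms
proof cases
  case (append_right C)
  note hX = append_right(3) and hC = append_right(4)
  define x c where "x = dim_row X" and "c = dim_row C"
  have cX: "X \<in> carrier_mat x x" and cC: "C \<in> carrier_mat c c"
    using hX hC by (simp_all only: x_def c_def is_hamiltonian_carrier)
  have "conserves (x * c) (ham_comp X C) (ham_comp (0\<^sub>m (Suc 0) (Suc 0)) (ham_comp X C)) (1\<^sub>m (x * c))"
    unfolding ham_comp_trivial(2)[OF ham_comp_carrier[OF cX cC]]
    by (rule conserves_one[OF ham_comp_carrier[OF cX cC]])
  moreover have "kron \<rho> (gibbs \<beta> C) = ptrace1 (Suc 0) (x * c) (1\<^sub>m (x * c) * kron \<rho> (gibbs \<beta> C) * cadj (1\<^sub>m (x * c)))"
    if "\<rho> \<in> carrier_mat x x" for \<rho>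
  proof -
    have "kron \<rho> (gibbs \<beta> C) \<in> carrier_mat (x * c) (x * c)"
      by (rule kron_carrier[OF that gibbs_carrier[OF cC]])
    then show ?thesis by (simp only: cadj_one left_mult_one_mat right_mult_one_mat ptrace1_one)
  qed
  ultimately have "dilates \<beta> X Y f C (gibbs \<beta> C) (0\<^sub>m (Suc 0) (Suc 0)) (1\<^sub>m (x * c))"
    unfolding dilates_def append_right(1,2) dim_ham_comp(1) index_zero_mat(2) x_def[symmetric] c_def[symmetric]
    using hX is_hamiltonian_ham_comp[OF hX hC] thermal_state_gibbs[OF hC] is_hamiltonian_zero[of "Suc 0"] by blast
  then show ?thesis by blast
next
  case (append_left C)
  note hX = append_left(3) and hC = append_left(4)
  define x c where "x = dim_row X" and "c = dim_row C"
  have cX: "X \<in> carrier_mat x x" and cC: "C \<in> carrier_mat c c"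
    using hX hC by (simp_all only: x_def c_def is_hamiltonian_carrier)
  have "conserves (x * c) (ham_comp X C) (ham_comp (0\<^sub>m (Suc 0) (Suc 0)) (ham_comp C X)) (swap_mat x c)"
    unfolding ham_comp_trivial(2)[OF ham_comp_carrier[OF cC cX]] mult.commute[of x c]
    by (rule conserves_swap[OF cX cC])
  moreover have "kron (gibbs \<beta> C) \<rho> = ptrace1 (Suc 0) (c * x) (swap_mat x c * kron \<rho> (gibbs \<beta> C) * cadj (swap_mat x c))"
    if "\<rho> \<in> carrier_mat x x" for \<rho>
  proof -
    have "kron \<rho> (gibbs \<beta> C) \<in> carrier_mat (c * x) (c * x)"
      using kron_carrier[OF that gibbs_carrier[OF cC]] by (simp only: mult.commute)
    then show ?thesis
      by (simp only: swap_mat_conj swap_sys_kron[OF that gibbs_carrier[OF cC]]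
          ptrace1_one[OF kron_carrier[OF gibbs_carrier[OF cC] that]])
  qed
  ultimately have "dilates \<beta> X Y f C (gibbs \<beta> C) (0\<^sub>m (Suc 0) (Suc 0)) (swap_mat x c)"
    unfolding dilates_def append_left(1,2) dim_ham_comp(1) index_zero_mat(2) x_def[symmetric] c_def[symmetric]
    using hX is_hamiltonian_ham_comp[OF hC hX] thermal_state_gibbs[OF hC] is_hamiltonian_zero[of "Suc 0"] by blast
  then show ?thesis by blast
next
  case (unitary U)
  note cX = is_hamiltonian_carrier[OF unitary(3)]
  have "dilates \<beta> X X f (0\<^sub>m (Suc 0) (Suc 0)) (1\<^sub>m (Suc 0)) (0\<^sub>m (Suc 0) (Suc 0)) U"
  proof (rule dilates_no_ancilla)
    show "conserves (dim_row X) X (ham_comp (0\<^sub>m (Suc 0) (Suc 0)) X) U"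
      unfolding ham_comp_trivial(2)[OF cX]
      using unitary(4-6) cX unfolding is_unitary_iff[OF unitary(4)] conserves_def by blast
    fix \<rho> :: "complex mat" assume "\<rho> \<in> carrier_mat (dim_row X) (dim_row X)"
    then have "U * \<rho> * cadj U \<in> carrier_mat (dim_row X) (dim_row X)"
      by (intro mult_carrier_mat[of _ _ "dim_row X"] cadj_carrier unitary(4))
    then show "f \<rho> = ptrace1 (dim_row (0\<^sub>m (Suc 0) (Suc 0) :: complex mat)) (dim_row X) (U * \<rho> * cadj U)"
      by (simp only: unitary(2) index_zero_mat ptrace1_one)
  qed (simp_all only: unitary(3) is_hamiltonian_zero zero_less_Suc)
  then show ?thesis unfolding unitary(1) by blast
next
  case (trace_right Z)
  define x z where "x = dim_row Y" and "z = dim_row Z"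
  have cY: "Y \<in> carrier_mat x x" and cZ: "Z \<in> carrier_mat z z"
    using trace_right(3,4) by (simp_all only: x_def z_def is_hamiltonian_carrier)
  have "dilates \<beta> X Y f (0\<^sub>m (Suc 0) (Suc 0)) (1\<^sub>m (Suc 0)) Z (swap_mat x z)"
    unfolding trace_right(1)
  proof (rule dilates_no_ancilla)
    show "conserves (dim_row (ham_comp Y Z)) (ham_comp Y Z) (ham_comp Z Y) (swap_mat x z)"
      unfolding dim_ham_comp(1) x_def[symmetric] z_def[symmetric] mult.commute[of x z] by (rule conserves_swap[OF cY cZ])
    fix \<rho> :: "complex mat" assume "\<rho> \<in> carrier_mat (dim_row (ham_comp Y Z)) (dim_row (ham_comp Y Z))"
    then have "\<rho> \<in> carrier_mat (z * x) (z * x)"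
      by (simp only: dim_ham_comp(1) x_def[symmetric] z_def[symmetric] mult.commute)
    then show "f \<rho> = ptrace1 (dim_row Z) (dim_row Y) (swap_mat x z * \<rho> * cadj (swap_mat x z))"
      by (simp only: trace_right(2) swap_mat_conj ptrace2_swap_sys x_def z_def)
  qed (simp_all only: trace_right(3,4) is_hamiltonian_ham_comp)
  then show ?thesis by blast
next
  case (trace_left Z)
  define x z where "x = dim_row Y" and "z = dim_row Z"
  have cY: "Y \<in> carrier_mat x x" and cZ: "Z \<in> carrier_mat z z"
    using trace_left(3,4) by (simp_all only: x_def z_def is_hamiltonian_carrier)
  have "dilates \<beta> X Y f (0\<^sub>m (Suc 0) (Suc 0)) (1\<^sub>m (Suc 0)) Z (1\<^sub>m (z * x))"
    unfolding trace_left(1)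
  proof (rule dilates_no_ancilla)
    show "conserves (dim_row (ham_comp Z Y)) (ham_comp Z Y) (ham_comp Z Y) (1\<^sub>m (z * x))"
      unfolding dim_ham_comp(1) x_def[symmetric] z_def[symmetric] by (rule conserves_one[OF ham_comp_carrier[OF cZ cY]])
    fix \<rho> :: "complex mat" assume "\<rho> \<in> carrier_mat (dim_row (ham_comp Z Y)) (dim_row (ham_comp Z Y))"
    then have \<rho>: "\<rho> \<in> carrier_mat (z * x) (z * x)"
      by (simp only: dim_ham_comp(1) x_def[symmetric] z_def[symmetric])
    show "f \<rho> = ptrace1 (dim_row Z) (dim_row Y) (1\<^sub>m (z * x) * \<rho> * cadj (1\<^sub>m (z * x)))"
      by (simp only: trace_left(2) cadj_one left_mult_one_mat[OF \<rho>] right_mult_one_mat[OF \<rho>])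
  qed (simp_all only: trace_left(3,4) is_hamiltonian_ham_comp)
  then show ?thesis by blast
next
  case (relabel W Z)
  define w z where "w = dim_row W" and "z = dim_row Z"
  have cW: "W \<in> carrier_mat w w" and cZ: "Z \<in> carrier_mat z z"
    using relabel(4,5) by (simp_all only: w_def z_def is_hamiltonian_carrier)
  have "dilates \<beta> X Y f (0\<^sub>m (Suc 0) (Suc 0)) (1\<^sub>m (Suc 0)) (0\<^sub>m (Suc 0) (Suc 0)) (swap_mat w z)"
    unfolding relabel(1,2)
  proof (rule dilates_no_ancilla)
    show "conserves (dim_row (ham_comp W Z)) (ham_comp W Z) (ham_comp (0\<^sub>m (Suc 0) (Suc 0)) (ham_comp Z W)) (swap_mat w z)"
      unfolding dim_ham_comp(1) w_def[symmetric] z_def[symmetric] mult.commute[of w z]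
        ham_comp_trivial(2)[OF ham_comp_carrier[OF cZ cW]]
      by (rule conserves_swap[OF cW cZ])
    fix \<rho> :: "complex mat" assume "\<rho> \<in> carrier_mat (dim_row (ham_comp W Z)) (dim_row (ham_comp W Z))"
    then have "\<rho> \<in> carrier_mat (z * w) (z * w)"
      by (simp only: dim_ham_comp(1) w_def[symmetric] z_def[symmetric] mult.commute)
    then show "f \<rho> = ptrace1 (dim_row (0\<^sub>m (Suc 0) (Suc 0) :: complex mat)) (dim_row (ham_comp Z W)) (swap_mat w z * \<rho> * cadj (swap_mat w z))"
      by (simp only: relabel(3) swap_mat_conj dim_ham_comp(1) index_zero_mat
          w_def[symmetric] z_def[symmetric] ptrace1_one[OF swap_sys_carrier])
  qed (simp_all only: relabel(4,5) is_hamiltonian_ham_comp is_hamiltonian_zero zero_less_Suc)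
  then show ?thesis by blast
qed

lemma thermal_op_dilates:
  assumes "thermal_op \<beta> X Y f"
  shows "\<exists>C s L V. dilates \<beta> X Y f C s L V"
  using assms
proof induction
  case (refl X)
  then show ?case using dilates_swap[OF _ thermal_state_trivial] by blast
next
  case (step X Y f Z g)
  obtain C s L V where "dilates \<beta> X Y f C s L V" using step.IH by blast
  moreover obtain D t M W where "dilates \<beta> Y Z g D t M W" using elem_step_dilates[OF step.hyps(2)] by blast
  ultimately show ?case using dilates_comp by blast
qed

text \<open>A dilation maps \<open>X \<otimes> C\<close> to a different factorisation \<open>L \<otimes> Y\<close>. Swapping the output
  into a fresh copy of \<open>Y\<close> and undoing the dilation yields a unitary on a system that depends on
  \<open>X\<close>, \<open>C\<close> and \<open>Y\<close> only, hence one that can be applied conditionally.\<close>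
lemma dilates_endomorphism:
  assumes "dilates \<beta> X Y f C s L V"
  shows "\<exists>U. conserves (dim_row X * dim_row C * dim_row Y) (ham_comp (ham_comp X C) Y) (ham_comp (ham_comp X C) Y) U \<and>
    (\<forall>\<rho> \<in> carrier_mat (dim_row X) (dim_row X). f \<rho> =
       ptrace1 (dim_row X * dim_row C) (dim_row Y) (U * kron (kron \<rho> s) (gibbs \<beta> Y) * cadj U))"
proof -
  obtain x y c l where dims: "dim_row X = x" "dim_row Y = y" "dim_row C = c" "dim_row L = l"
    and cf: "X \<in> carrier_mat x x" "Y \<in> carrier_mat y y" "C \<in> carrier_mat c c" "L \<in> carrier_mat l l"
    and hY: "is_hamiltonian Y"
    and s: "s \<in> carrier_mat c c" and xc: "x * c = l * y"
    and V: "conserves (x * c) (ham_comp X C) (ham_comp L Y) V"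
    and fV: "\<And>\<rho>. \<rho> \<in> carrier_mat x x \<Longrightarrow> f \<rho> = ptrace1 l y (V * kron \<rho> s * cadj V)"
    by (rule dilatesE[OF assms]) blast
  let ?K = "kron V (1\<^sub>m y)" and ?S = "kron (1\<^sub>m l) (swap_mat y y)" and ?\<gamma> = "gibbs \<beta> Y"
  \<comment> \<open>Read from the right: dilate, exchange the output with the fresh copy of
    \<open>Y\<close>, undo the dilation.\<close>
  let ?U = "cadj ?K * (?S * ?K)"
  have \<gamma>: "?\<gamma> \<in> carrier_mat y y" "mtrace ?\<gamma> = 1" using gibbs_carrier[OF cf(2)] mtrace_gibbs[OF hY] by auto
  have n: "l * (y * y) = x * c * y" by (simp add: xc mult.assoc)
  have K: "conserves (x * c * y) (ham_comp (ham_comp X C) Y) (ham_comp L (ham_comp Y Y)) ?K"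
    using conserves_kron_left[OF V cf(2)] by (simp only: ham_comp_assoc[OF cf(4,2,2)])
  have S: "conserves (x * c * y) (ham_comp L (ham_comp Y Y)) (ham_comp L (ham_comp Y Y)) ?S"
    using conserves_kron_right[OF conserves_swap[OF cf(2,2)] cf(4)] by (simp only: n)
  have U: "conserves (x * c * y) (ham_comp (ham_comp X C) Y) (ham_comp (ham_comp X C) Y) ?U"
    by (rule conserves_mult[OF conserves_mult[OF K S] conserves_cadj[OF K]])
  have Vc: "V \<in> carrier_mat (x * c) (x * c)" "cadj V \<in> carrier_mat (x * c) (x * c)" "V * cadj V = 1\<^sub>m (x * c)"
    using V by (auto simp: conserves_def)
  have Kc: "?K \<in> carrier_mat (x * c * y) (x * c * y)" "cadj ?K \<in> carrier_mat (x * c * y) (x * c * y)"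
    and Sc: "?S \<in> carrier_mat (x * c * y) (x * c * y)" "cadj ?S \<in> carrier_mat (x * c * y) (x * c * y)"
    using K S by (auto simp: conserves_def)
  have "f \<rho> = ptrace1 (x * c) y (?U * kron (kron \<rho> s) ?\<gamma> * cadj ?U)" if \<rho>: "\<rho> \<in> carrier_mat x x" for \<rho>
  proof -
    have rs: "kron \<rho> s \<in> carrier_mat (x * c) (x * c)" using \<rho> s by simp
    let ?A = "V * kron \<rho> s * cadj V"
    have A: "?A \<in> carrier_mat (l * y) (l * y)"
      unfolding xc[symmetric] by (intro mult_carrier_mat[of _ _ "x * c"] Vc rs)
    have Ag: "kron ?A ?\<gamma> \<in> carrier_mat (x * c * y) (x * c * y)"
      using kron_carrier[OF A \<gamma>(1)] by (simp only: xc)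
    have Ag': "kron ?A ?\<gamma> \<in> carrier_mat (l * (y * y)) (l * (y * y))"
      using Ag by (simp only: n)
    let ?B = "?S * kron ?A ?\<gamma> * cadj ?S"
    have B: "?B \<in> carrier_mat (x * c * y) (x * c * y)"
      by (intro mult_carrier_mat[of _ _ "x * c * y"] Sc Ag)
    let ?P = "ptrace1 l y ?A"
    have sP: "kron ?P ?\<gamma> \<in> carrier_mat (y * y) (y * y)" using \<gamma> by simp
    have "?U * kron (kron \<rho> s) ?\<gamma> * cadj ?U
       = cadj ?K * (?S * (?K * kron (kron \<rho> s) ?\<gamma> * cadj ?K) * cadj ?S) * cadj (cadj ?K)"
      by (simp only: mult_conj[OF Kc(2) mult_carrier_mat[OF Sc(1) Kc(1)] kron_carrier[OF rs \<gamma>(1)]]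
          mult_conj[OF Sc(1) Kc(1) kron_carrier[OF rs \<gamma>(1)]])
    also have "\<dots> = kron (cadj V) (1\<^sub>m y) * ?B * cadj (kron (cadj V) (1\<^sub>m y))"
      unfolding kron_conj_left[OF Vc(1) rs \<gamma>(1)] by (simp only: cadj_kron cadj_one cadj_cadj)
    \<comment> \<open>The inverse dilation acts only on the factor of dimension
      \<open>x * c\<close>, which is discarded as a whole, so it cancels. This holds even if
      \<open>?A\<close> correlates the environment with the output.\<close>
    finally have "ptrace1 (x * c) y (?U * kron (kron \<rho> s) ?\<gamma> * cadj ?U) = ptrace1 (x * c) y ?B"
      using ptrace1_conj_left[OF Vc(2) _ B] by (simp only: cadj_cadj Vc(3))
    also have "\<dots> = ptrace1 y y (ptrace1 l (y * y) ?B)"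
      by (simp only: xc ptrace1_ptrace1)
    also have "ptrace1 l (y * y) ?B = swap_mat y y * kron ?P ?\<gamma> * cadj (swap_mat y y)"
      by (simp only: ptrace1_conj_right[OF swap_mat_carrier Ag'] kron_ptrace1[OF A \<gamma>(1)])
    \<comment> \<open>The output is now in the last slot and the Gibbs state in the slot still to be
      discarded, where it contributes the factor 1.\<close>
    also have "\<dots> = kron ?\<gamma> ?P"
      by (simp only: swap_mat_conj[OF sP] swap_sys_kron[OF ptrace1_carrier \<gamma>(1)])
    also have "ptrace1 y y \<dots> = ?P"
      by (simp only: ptrace1_kron[OF \<gamma>(1) ptrace1_carrier] \<gamma>(2) one_smult_mat)
    finally show ?thesis by (simp only: fV[OF \<rho>])
  qed
  with U show ?thesis unfolding dims by blast
qed

section \<open>Mixtures\<close>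

text \<open>The cross terms contain \<open>P * Q\<close> or \<open>Q * P\<close> and vanish, so
  block-diagonal operators multiply block by block. Unitarity of the controlled unitary, its energy
  conservation and its action on states are all instances.\<close>

lemma kron_sum_mult:
  assumes P: "P \<in> carrier_mat n n" "P * P = P" and Q: "Q \<in> carrier_mat n n" "Q * Q = Q"
    and PQ: "P * Q = 0\<^sub>m n n" "Q * P = 0\<^sub>m n n"
    and c: "A \<in> carrier_mat s s" "B \<in> carrier_mat s s" "C \<in> carrier_mat s s" "D \<in> carrier_mat s s"
  shows "(kron P A + kron Q B) * (kron P C + kron Q D) = kron P (A * C) + kron Q (B * D)"
proof -
  have k: "kron M N \<in> carrier_mat (n * s) (n * s)" if "M \<in> carrier_mat n n" "N \<in> carrier_mat s s" for M N
    using that by simp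
  note km = kron_mult[of _ n n _ s s _ n _ s]
  have "(kron P A + kron Q B) * (kron P C + kron Q D)
     = kron P A * (kron P C + kron Q D) + kron Q B * (kron P C + kron Q D)"
    by (rule add_mult_distrib_mat[of _ "n * s" "n * s" _ _ "n * s"]) (auto intro!: k add_carrier_mat P Q c)
  also have "kron P A * (kron P C + kron Q D) = kron P A * kron P C + kron P A * kron Q D"
    by (rule mult_add_distrib_mat) (auto intro!: k P Q c)
  also have "\<dots> = kron P (A * C)"
    using P Q c by (simp add: km PQ kron_zero_left mult_carrier_mat[of _ s s _ s])
  also have "kron Q B * (kron P C + kron Q D) = kron Q B * kron P C + kron Q B * kron Q D"
    by (rule mult_add_distrib_mat) (auto intro!: k P Q c)
  also have "\<dots> = kron Q (B * D)"
    using P Q c by (simp add: km PQ kron_zero_left mult_carrier_mat[of _ s s _ s])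
  finally show ?thesis .
qed

lemma mult_diag_index:
  fixes f g :: "nat \<Rightarrow> complex"
  shows "mat n n (\<lambda>(i,j). if i = j then f i else 0) * mat n n (\<lambda>(i,j). if i = j then g i else 0)
    = mat n n (\<lambda>(i,j). if i = j then f i * g i else 0)"
proof (rule eq_matI)
  let ?F = "\<lambda>f. mat n n (\<lambda>(i,j). if i = j then f i else 0) :: complex mat"
  fix i j assume "i < dim_row (?F (\<lambda>i. f i * g i))" "j < dim_col (?F (\<lambda>i. f i * g i))"
  then have ij: "i < n" "j < n" by auto
  have "(?F f * ?F g) $$ (i,j) = (\<Sum>k<n. ?F f $$ (i,k) * ?F g $$ (k,j))"
    by (rule mult_index[of _ n n _ n]) (use ij in auto)
  also have "\<dots> = (\<Sum>k<n. if k = i then f i * (if i = j then g i else 0) else 0)"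
    by (intro sum.cong HOL.refl) (use ij in auto)
  also have "\<dots> = f i * (if i = j then g i else 0)" using ij by simp
  finally show "(?F f * ?F g) $$ (i,j) = ?F (\<lambda>i. f i * g i) $$ (i,j)" using ij by simp
qed auto

lemma thermal_op_unitary_mixture:
  assumes hH: "is_hamiltonian H" and H: "H \<in> carrier_mat s s"
    and U: "conserves s H H U" and U': "conserves s H H U'" and n: "0 < n" "m \<le> n"
  shows "\<exists>F. thermal_op \<beta> H H F \<and> (\<forall>\<rho> \<in> carrier_mat s s. F \<rho> =
    complex_of_real (real m / real n) \<cdot>\<^sub>m (U * \<rho> * cadj U) +
    complex_of_real (1 - real m / real n) \<cdot>\<^sub>m (U' * \<rho> * cadj U'))"
proof -
  \<comment> \<open>\<open>P\<close> and \<open>Q\<close> project on the register levels below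
    \<open>m\<close> and on the remaining ones. Their traces \<open>m\<close> and
    \<open>n - m\<close>, divided by \<open>n\<close>, become the weights.\<close>
  define P :: "complex mat" where "P = mat n n (\<lambda>(i,j). if i = j then (if i < m then 1 else 0) else 0)"
  define Q :: "complex mat" where "Q = mat n n (\<lambda>(i,j). if i = j then (if i < m then 0 else 1) else 0)"
  have P: "P \<in> carrier_mat n n" "P * P = P" and Q: "Q \<in> carrier_mat n n" "Q * Q = Q"
    unfolding P_def Q_def mult_diag_index by (auto intro!: eq_matI)
  have PQ: "P * Q = 0\<^sub>m n n" "Q * P = 0\<^sub>m n n" and sum: "P + Q = 1\<^sub>m n"
    and adj: "cadj P = P" "cadj Q = Q"
    unfolding P_def Q_def mult_diag_index by (auto intro!: eq_matI)
  have "mtrace P = (\<Sum>i<n. if i < m then 1 else 0)" by (simp add: mtrace_def P_def)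
  also have "\<dots> = (\<Sum>i\<in>{..<n} \<inter> {i. i < m}. 1)" by (simp add: sum.If_cases)
  also have "{..<n} \<inter> {i. i < m} = {..<m}" using n by auto
  finally have trP: "mtrace P = of_nat m" by simp
  have "mtrace P + mtrace Q = mtrace (1\<^sub>m n)"
    unfolding sum[symmetric] using P Q by (simp add: mtrace_def sum.distrib)
  then have trQ: "mtrace Q = of_nat n - of_nat m" using trP by (simp add: mtrace_def algebra_simps)
  note mult = kron_sum_mult[OF P Q PQ, where s = s]
  have split: "kron (1\<^sub>m n) M = kron P M + kron Q M" for M
    unfolding sum[symmetric] by (rule kron_add_left[OF P(1) Q(1)])
  have c: "U \<in> carrier_mat s s" "U' \<in> carrier_mat s s" "cadj U \<in> carrier_mat s s" "cadj U' \<in> carrier_mat s s"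
    and u: "U * cadj U = 1\<^sub>m s" "cadj U * U = 1\<^sub>m s" "U * H = H * U"
    and u': "U' * cadj U' = 1\<^sub>m s" "cadj U' * U' = 1\<^sub>m s" "U' * H = H * U'"
    using U U' by (auto simp: conserves_def)
  have k: "kron M N \<in> carrier_mat (n * s) (n * s)" if "M \<in> carrier_mat n n" "N \<in> carrier_mat s s" for M N
    using that by simp
  define K :: "complex mat" where "K = 0\<^sub>m n n"
  \<comment> \<open>\<open>W\<close> applies \<open>U\<close> or \<open>U'\<close> according to the
    register level.\<close>
  define W where "W = kron P U + kron Q U'"
  have W: "W \<in> carrier_mat (n * s) (n * s)" unfolding W_def by (intro add_carrier_mat k Q c)
  have aW: "cadj W = kron P (cadj U) + kron Q (cadj U')"
    unfolding W_def cadj_add[OF k[OF P(1) c(1)] k[OF Q(1) c(2)]] by (simp only: cadj_kron adj)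
  have one: "kron P (1\<^sub>m s) + kron Q (1\<^sub>m s) = 1\<^sub>m (n * s)"
    unfolding split[symmetric] by simp
  have hK: "is_hamiltonian K" unfolding K_def by (rule is_hamiltonian_zero[OF n(1)])
  \<comment> \<open>With no register energy, both blocks of the total Hamiltonian equal
    \<open>H\<close>. It therefore suffices that \<open>U\<close> and \<open>U'\<close> each commute
    with \<open>H\<close>.\<close>
  have KH: "ham_comp K H = kron P H + kron Q H"
    unfolding split[symmetric] ham_comp_def K_def using H
    by (simp add: kron_zero_left left_add_zero_mat[OF k[OF one_carrier_mat H]])
  have dims: "dim_row K = n" "dim_row H = s" "dim_row (ham_comp K H) = n * s"
    using H by (auto simp: K_def)
  have weights: "(1 / of_nat n) \<cdot>\<^sub>m (of_nat m \<cdot>\<^sub>m R + (of_nat n - of_nat m) \<cdot>\<^sub>m R')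
      = complex_of_real (real m / real n) \<cdot>\<^sub>m R + complex_of_real (1 - real m / real n) \<cdot>\<^sub>m R'"
    if "R \<in> carrier_mat s s" "R' \<in> carrier_mat s s" for R R'
    using that n(1) by (intro eq_matI) (auto simp: field_simps)
  have "elem_step \<beta> (ham_comp K H) (ham_comp K H) (\<lambda>\<rho>. W * \<rho> * cadj W)"
  proof (rule elem_step.unitary)
    show "is_unitary W"
      unfolding is_unitary_iff[OF W]
      unfolding aW unfolding W_def by (simp only: mult c u u' one HOL.simp_thms)
    show "W * ham_comp K H = ham_comp K H * W"
      unfolding KH unfolding W_def by (simp only: mult c H u u')
  qed (use W in \<open>simp_all only: dims is_hamiltonian_ham_comp[OF hK hH]\<close>)
  from thermal_op.step[OF thermal_op.step[OF thermal_op_elem_step[OF hH append_left[OF hH hK]] this]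
      trace_left[OF hK hH]]
  have "thermal_op \<beta> H H (ptrace1 (dim_row K) (dim_row H) \<circ> ((\<lambda>\<rho>. W * \<rho> * cadj W) \<circ> kron (gibbs \<beta> K)))"
    (is "thermal_op _ _ _ ?F") .
  moreover have "?F \<rho> = complex_of_real (real m / real n) \<cdot>\<^sub>m (U * \<rho> * cadj U) +
    complex_of_real (1 - real m / real n) \<cdot>\<^sub>m (U' * \<rho> * cadj U')" if \<rho>: "\<rho> \<in> carrier_mat s s" for \<rho>
  proof -
    let ?R = "U * \<rho> * cadj U" and ?R' = "U' * \<rho> * cadj U'"
    have R: "?R \<in> carrier_mat s s" "?R' \<in> carrier_mat s s" "U * \<rho> \<in> carrier_mat s s" "U' * \<rho> \<in> carrier_mat s s"
      using c \<rho> by (auto intro!: mult_carrier_mat[of _ s s _ s])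
    have I: "kron P \<rho> + kron Q \<rho> \<in> carrier_mat (n * s) (n * s)"
      by (intro add_carrier_mat k Q \<rho>)
    \<comment> \<open>The maximally mixed register is block diagonal for \<open>P\<close> and
      \<open>Q\<close>, so no coherence between the two branches arises and discarding the register
      adds them.\<close>
    have "kron (gibbs \<beta> K) \<rho> = (1 / of_nat n) \<cdot>\<^sub>m (kron P \<rho> + kron Q \<rho>)"
      unfolding K_def gibbs_zero by (simp only: kron_smult_left split)
    then have "W * kron (gibbs \<beta> K) \<rho> * cadj W = (1 / of_nat n) \<cdot>\<^sub>m (W * (kron P \<rho> + kron Q \<rho>) * cadj W)"
      by (simp only: mult_smult_distrib[OF W I] mult_smult_assoc_mat[OF mult_carrier_mat[OF W I] cadj_carrier[OF W]])
    also have "W * (kron P \<rho> + kron Q \<rho>) * cadj W = kron P ?R + kron Q ?R'"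
      unfolding aW unfolding W_def by (simp only: mult c \<rho> R)
    finally have "?F \<rho> = (1 / of_nat n) \<cdot>\<^sub>m (of_nat m \<cdot>\<^sub>m ?R + (of_nat n - of_nat m) \<cdot>\<^sub>m ?R')"
      by (simp only: comp_def dims ptrace1_smult[OF add_carrier_mat[OF k[OF Q(1) R(2)]]]
          ptrace1_add[OF k[OF P(1) R(1)] k[OF Q(1) R(2)]] ptrace1_kron[OF P(1) R(1)] ptrace1_kron[OF Q(1) R(2)] trP trQ)
    also have "\<dots> = complex_of_real (real m / real n) \<cdot>\<^sub>m ?R + complex_of_real (1 - real m / real n) \<cdot>\<^sub>m ?R'"
      by (rule weights[OF R(1,2)])
    finally show ?thesis .
  qed
  ultimately show ?thesis by blast
qed

text \<open>Over a common ancilla both operations share preparation and discard and differ only in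
  the energy-conserving unitary in between. Mixing these unitaries mixes the operations, since the
  partial trace is linear.\<close>

lemma thermal_op_rational_mixture:
  assumes hA: "is_hamiltonian A" and hA': "is_hamiltonian A'"
    and f: "thermal_op \<beta> A A' f" and g: "thermal_op \<beta> A A' g" and n: "0 < n" "m \<le> n"
  shows "\<exists>F. thermal_op \<beta> A A' F \<and> (\<forall>\<rho> \<in> carrier_mat (dim_row A) (dim_row A). F \<rho> =
    complex_of_real (real m / real n) \<cdot>\<^sub>m f \<rho> + complex_of_real (1 - real m / real n) \<cdot>\<^sub>m g \<rho>)"
proof -
  obtain C1 s1 L1 V1 where f1: "dilates \<beta> A A' f C1 s1 L1 V1" using thermal_op_dilates[OF f] by blast
  obtain C2 s2 L2 V2 where g1: "dilates \<beta> A A' g C2 s2 L2 V2" using thermal_op_dilates[OF g] by blast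
  have C1: "thermal_state \<beta> C1 s1" and C2: "thermal_state \<beta> C2 s2"
    using f1 g1 by (simp_all only: dilates_def)
  define C s where "C = ham_comp C1 C2" and "s = kron s1 s2"
  have C: "thermal_state \<beta> C s" unfolding C_def s_def by (rule thermal_state_kron[OF C1 C2])
  then have hC: "is_hamiltonian C" and sc: "s \<in> carrier_mat (dim_row C) (dim_row C)"
    by (simp_all only: thermal_state_def)
  define a a' c where "a = dim_row A" and "a' = dim_row A'" and "c = dim_row C"
  have cA: "A \<in> carrier_mat a a" and cA': "A' \<in> carrier_mat a' a'" and cC: "C \<in> carrier_mat c c" and sc: "s \<in> carrier_mat c c"
    using hA hA' hC sc by (simp_all only: a_def a'_def c_def is_hamiltonian_carrier)
  \<comment> \<open>Padding with \<open>C2\<close> comes after \<open>f\<close>, padding with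
    \<open>C1\<close> comes before \<open>g\<close>. Both ancillas are then
    \<open>ham_comp C1 C2\<close> in the same order.\<close>
  obtain L V where "dilates \<beta> A A' ((\<lambda>\<rho>. \<rho>) \<circ> f) C s L V"
    unfolding C_def s_def using dilates_comp[OF f1 dilates_swap[OF hA' C2]] by blast
  then have "dilates \<beta> A A' f C s L V" by (simp add: comp_def)
  from dilates_endomorphism[OF this] obtain U where
    U: "conserves (a * c * a') (ham_comp (ham_comp A C) A') (ham_comp (ham_comp A C) A') U"
    "\<And>\<rho>. \<rho> \<in> carrier_mat a a \<Longrightarrow> f \<rho> = ptrace1 (a * c) a' (U * kron (kron \<rho> s) (gibbs \<beta> A') * cadj U)"
    unfolding a_def a'_def c_def by blast
  obtain L' V' where "dilates \<beta> A A' (g \<circ> (\<lambda>\<rho>. \<rho>)) C s L' V'"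
    unfolding C_def s_def using dilates_comp[OF dilates_swap[OF hA C1] g1] by blast
  then have "dilates \<beta> A A' g C s L' V'" by (simp add: comp_def)
  from dilates_endomorphism[OF this] obtain U' where
    U': "conserves (a * c * a') (ham_comp (ham_comp A C) A') (ham_comp (ham_comp A C) A') U'"
    "\<And>\<rho>. \<rho> \<in> carrier_mat a a \<Longrightarrow> g \<rho> = ptrace1 (a * c) a' (U' * kron (kron \<rho> s) (gibbs \<beta> A') * cadj U')"
    unfolding a_def a'_def c_def by blast
  let ?AC = "ham_comp A C"
  let ?S = "ham_comp ?AC A'"
  have hAC: "is_hamiltonian ?AC" and hS: "is_hamiltonian ?S"
    using hA hC hA' by (simp_all only: is_hamiltonian_ham_comp)
  have S: "?S \<in> carrier_mat (a * c * a') (a * c * a')"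
    by (intro ham_comp_carrier cA cC cA')
  obtain F where F: "thermal_op \<beta> ?S ?S F" "\<And>\<rho>. \<rho> \<in> carrier_mat (a * c * a') (a * c * a') \<Longrightarrow> F \<rho> =
    complex_of_real (real m / real n) \<cdot>\<^sub>m (U * \<rho> * cadj U) +
    complex_of_real (1 - real m / real n) \<cdot>\<^sub>m (U' * \<rho> * cadj U')"
    using thermal_op_unitary_mixture[OF hS S U(1) U'(1) n] by blast
  obtain G where G: "thermal_op \<beta> A ?AC G" "\<And>\<rho>. \<rho> \<in> carrier_mat a a \<Longrightarrow> G \<rho> = kron \<rho> s"
    using C hA unfolding thermal_state_def a_def by blast
  let ?E = "ptrace1 (dim_row ?AC) (dim_row A') \<circ> (F \<circ> ((\<lambda>\<rho>. kron \<rho> (gibbs \<beta> A')) \<circ> G))"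
  have "thermal_op \<beta> A A' ?E"
    by (rule thermal_op.step[OF thermal_op_trans[OF F(1) thermal_op.step[OF G(1) append_right[OF hAC hA']]]
          trace_left[OF hAC hA']])
  moreover have "?E \<rho> = complex_of_real (real m / real n) \<cdot>\<^sub>m f \<rho> + complex_of_real (1 - real m / real n) \<cdot>\<^sub>m g \<rho>"
    if \<rho>: "\<rho> \<in> carrier_mat a a" for \<rho>
  proof -
    let ?R = "kron (kron \<rho> s) (gibbs \<beta> A')"
    have R: "?R \<in> carrier_mat (a * c * a') (a * c * a')"
      by (intro kron_carrier \<rho> sc gibbs_carrier cA')
    have c: "U * ?R * cadj U \<in> carrier_mat (a * c * a') (a * c * a')" "U' * ?R * cadj U' \<in> carrier_mat (a * c * a') (a * c * a')"
      using U(1) U'(1) R unfolding conserves_def by (auto intro!: mult_carrier_mat[of _ "a * c * a'" "a * c * a'" _ "a * c * a'"])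
    show ?thesis
      by (simp only: comp_def G(2)[OF \<rho>] F(2)[OF R] dim_ham_comp(1) a_def[symmetric] a'_def[symmetric] c_def[symmetric]
          ptrace1_add[OF smult_carrier_mat[OF c(1)] smult_carrier_mat[OF c(2)]]
          ptrace1_smult[OF c(1)] ptrace1_smult[OF c(2)] U(2)[OF \<rho>] U'(2)[OF \<rho>])
  qed
  ultimately show ?thesis unfolding a_def by blast
qed

section \<open>Passage to the limit\<close>

text \<open>Immediate from a dilation, whose last operation is a partial trace onto
  \<open>Y\<close>.\<close>

lemma thermal_op_carrier:
  assumes "thermal_op \<beta> X Y f" "\<rho> \<in> carrier_mat (dim_row X) (dim_row X)"
  shows "f \<rho> \<in> carrier_mat (dim_row Y) (dim_row Y)"
proof -
  obtain C s L V where "dilates \<beta> X Y f C s L V" using thermal_op_dilates[OF assms(1)] by blast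
  then show ?thesis using assms(2) unfolding dilates_def by (metis ptrace1_carrier)
qed

theorem theorem1:
  fixes \<beta> :: real and A A' :: "complex mat" and E1 E2 :: "complex mat \<Rightarrow> complex mat" and p :: real
  assumes "\<beta> > 0"
    and "is_hamiltonian A" and "is_hamiltonian A'"
    and "E1 \<in> CTO \<beta> A A'" and "E2 \<in> CTO \<beta> A A'"
    and "0 \<le> p" and "p \<le> 1"
  shows "(\<lambda>\<rho>. complex_of_real p \<cdot>\<^sub>m E1 \<rho> + complex_of_real (1 - p) \<cdot>\<^sub>m E2 \<rho>) \<in> CTO \<beta> A A'"
proof -
  let ?D = "carrier_mat (dim_row A) (dim_row A)"
  define y where "y = dim_row A'"
  obtain f where f: "\<And>k. thermal_op \<beta> A A' (f k)" "\<And>\<rho>. \<rho> \<in> ?D \<Longrightarrow> mat_tendsto (\<lambda>k. f k \<rho>) (E1 \<rho>)"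
    using assms(4) unfolding CTO_def by blast
  obtain g where g: "\<And>k. thermal_op \<beta> A A' (g k)" "\<And>\<rho>. \<rho> \<in> ?D \<Longrightarrow> mat_tendsto (\<lambda>k. g k \<rho>) (E2 \<rho>)"
    using assms(5) unfolding CTO_def by blast
  \<comment> \<open>Rounding \<open>p\<close> down to a multiple of \<open>1 / Suc k\<close> gives a
    weight in range with error at most \<open>1 / Suc k\<close>; the successor keeps the denominator
    positive.\<close>
  define m where "m k = nat \<lfloor>p * real (Suc k)\<rfloor>" for k
  define q where "q k = real (m k) / real (Suc k)" for k
  have floor: "real (m k) = of_int \<lfloor>p * real (Suc k)\<rfloor>" for k
    using assms(6) by (simp add: m_def)
  have mle: "m k \<le> Suc k" for k
  proof -
    have "real (m k) \<le> p * real (Suc k)" unfolding floor by (rule of_int_floor_le)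
    also have "\<dots> \<le> real (Suc k)" using assms(7) by (intro mult_left_le_one_le) (use assms(6) in auto)
    finally show ?thesis by (simp only: of_nat_le_iff)
  qed
  have q: "q \<longlonglongrightarrow> p"
  proof (rule tendsto_sandwich)
    show "\<forall>\<^sub>F k in sequentially. p - 1 / real (Suc k) \<le> q k"
    proof (intro always_eventually allI)
      fix k
      have "p * real (Suc k) - 1 \<le> real (m k)" unfolding floor by linarith
      then have "(p * real (Suc k) - 1) / real (Suc k) \<le> q k" unfolding q_def by (intro divide_right_mono) auto
      then show "p - 1 / real (Suc k) \<le> q k" by (simp add: diff_divide_distrib del: of_nat_Suc)
    qed
    show "\<forall>\<^sub>F k in sequentially. q k \<le> p"
    proof (intro always_eventually allI)
      fix k
      have "real (m k) \<le> p * real (Suc k)" unfolding floor by (rule of_int_floor_le)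
      then show "q k \<le> p" unfolding q_def by (simp add: divide_le_eq del: of_nat_Suc)
    qed
    have "(\<lambda>k. p - inverse (real (Suc k))) \<longlonglongrightarrow> p - 0"
      by (intro tendsto_intros LIMSEQ_inverse_real_of_nat)
    then show "(\<lambda>k. p - 1 / real (Suc k)) \<longlonglongrightarrow> p" by (simp add: inverse_eq_divide del: of_nat_Suc)
  qed simp
  \<comment> \<open>Weight and operations advance with the same index \<open>k\<close>, so one limit
    handles both approximations.\<close>
  have "\<exists>F. thermal_op \<beta> A A' F \<and> (\<forall>\<rho> \<in> ?D. F \<rho> =
      complex_of_real (q k) \<cdot>\<^sub>m f k \<rho> + complex_of_real (1 - q k) \<cdot>\<^sub>m g k \<rho>)" for k
    unfolding q_def by (rule thermal_op_rational_mixture[OF assms(2,3) f(1) g(1) zero_less_Suc mle])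
  then obtain F where F: "\<And>k. thermal_op \<beta> A A' (F k)" "\<And>k \<rho>. \<rho> \<in> ?D \<Longrightarrow> F k \<rho> =
      complex_of_real (q k) \<cdot>\<^sub>m f k \<rho> + complex_of_real (1 - q k) \<cdot>\<^sub>m g k \<rho>"
    by metis
  have "mat_tendsto (\<lambda>k. F k \<rho>) (complex_of_real p \<cdot>\<^sub>m E1 \<rho> + complex_of_real (1 - p) \<cdot>\<^sub>m E2 \<rho>)"
    if \<rho>: "\<rho> \<in> ?D" for \<rho>
  proof -
    have fc: "f k \<rho> \<in> carrier_mat y y" and gc: "g k \<rho> \<in> carrier_mat y y" for k
      unfolding y_def using thermal_op_carrier[OF f(1) \<rho>] thermal_op_carrier[OF g(1) \<rho>] by blast+
    \<comment> \<open>\<open>mat_tendsto\<close> ties the shape of a limit to that of its sequence.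
      This makes \<open>E1 \<rho>\<close> and \<open>E2 \<rho>\<close> matrices of equal size, so
      that their sum is the entrywise one.\<close>
    have "f 0 \<rho> \<in> carrier_mat (dim_row (E1 \<rho>)) (dim_col (E1 \<rho>))" "g 0 \<rho> \<in> carrier_mat (dim_row (E2 \<rho>)) (dim_col (E2 \<rho>))"
      using f(2)[OF \<rho>] g(2)[OF \<rho>] unfolding mat_tendsto_def by blast+
    with fc[of 0] gc[of 0] have d: "dim_row (E1 \<rho>) = y" "dim_col (E1 \<rho>) = y" "dim_row (E2 \<rho>) = y" "dim_col (E2 \<rho>) = y"
      unfolding carrier_mat_def by simp_all
    have "(\<lambda>k. (complex_of_real (q k) \<cdot>\<^sub>m f k \<rho> + complex_of_real (1 - q k) \<cdot>\<^sub>m g k \<rho>) $$ (i,j))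
        \<longlonglongrightarrow> (complex_of_real p \<cdot>\<^sub>m E1 \<rho> + complex_of_real (1 - p) \<cdot>\<^sub>m E2 \<rho>) $$ (i,j)"
      if ij: "i < y" "j < y" for i j
    proof -
      have "(\<lambda>k. f k \<rho> $$ (i,j)) \<longlonglongrightarrow> E1 \<rho> $$ (i,j)" "(\<lambda>k. g k \<rho> $$ (i,j)) \<longlonglongrightarrow> E2 \<rho> $$ (i,j)"
        using f(2)[OF \<rho>] g(2)[OF \<rho>] ij unfolding mat_tendsto_def d by blast+
      then have "(\<lambda>k. complex_of_real (q k) * f k \<rho> $$ (i,j) + complex_of_real (1 - q k) * g k \<rho> $$ (i,j))
        \<longlonglongrightarrow> complex_of_real p * E1 \<rho> $$ (i,j) + complex_of_real (1 - p) * E2 \<rho> $$ (i,j)"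
        by (intro tendsto_intros q)
      then show ?thesis using ij d carrier_matD[OF fc] carrier_matD[OF gc] by simp
    qed
    moreover have "complex_of_real (q k) \<cdot>\<^sub>m f k \<rho> + complex_of_real (1 - q k) \<cdot>\<^sub>m g k \<rho> \<in> carrier_mat y y" for k
      by (intro add_carrier_mat smult_carrier_mat gc)
    ultimately show ?thesis
      unfolding mat_tendsto_def F(2)[OF \<rho>] index_add_mat index_smult_mat d by blast
  qed
  with F(1) show ?thesis unfolding CTO_def by blast
qed

end
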